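(* Suppose that $\beta_\ast$ is random with $\mathbb{E}[\beta_\ast]=0$ and $\mathbb{E}[\beta_\ast\beta_\ast^\top]=\frac{\alpha^2}{p}I_p$ for some $\alpha>0$ and is independent of $X_n,\tilde x,\varepsilon_n,\tilde\varepsilon$; that there exists $\delta>0$ with $\mathbb{E}[|Z_{ij}|^{4+\delta}],\mathbb{E}[|\tilde z_j|^{4+\delta}]<+\infty$ for all $i,j$; and that there exists $\gamma_{\max}>0$ with $\sup_{n\ge1}\max_{1\le i\le n,\,1\le j\le p}\{|\gamma_{ij}^{(n)}|,|\tilde\gamma_j^{(n)}|\}<\gamma_{\max}$. Then both functions $\lambda\mapsto\hat r_\lambda^{test}(X_n)$ and $\lambda\mapsto r_\lambda^{test}(X_n)$ on $(0,\infty)$ reach their minimum at $\lambda_\ast=\frac{\sigma^2p}{\alpha^2n}$, that is, for any $\lambda>0$, $$\hat r_{\lambda_\ast}^{test}(X_n)\le\hat r_\lambda^{test}(X_n)\qquad\text{and}\qquad r_{\lambda_\ast}^{test}(X_n)\le r_\lambda^{test}(X_n).$$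
   Context: Design: $X_n=\Upsilon_n\circ Z_n\in\mathbb{R}^{n\times p}$, where $\circ$ is the entrywise product, $\Upsilon_n=(\gamma_{ij}^{(n)})$ is a deterministic real $n\times p$ matrix, and $Z_n=(Z_{ij})$ is a real random matrix with i.i.d. centered entries of variance one. Write $\gamma_{ij}=\gamma_{ij}^{(n)}$. Model: $Y_n=X_n\beta_\ast+\varepsilon_n\in\mathbb{R}^n$, where $\varepsilon_n$ has i.i.d. entries with mean $0$ and variance $\sigma^2>0$ and is independent of $X_n$. Ridge estimator: $\hat\theta_\lambda=(X_n^\top X_n+n\lambda I_p)^{-1}X_n^\top Y_n$, $\lambda>0$. Test point: $\tilde y=\tilde x^\top\beta_\ast+\tilde\varepsilon$ with $\mathbb{E}[\tilde\varepsilon]=0$, $\mathbb{E}[\tilde\varepsilon^2]=\sigma^2$, and $\tilde x=\widetilde S_p^{1/2}\tilde z$, where $\tilde z=(\tilde z_j)\in\mathbb{R}^p$ has i.i.d. centered entries of variance one and $\widetilde S_p=\operatorname{diag}(\tilde\gamma_1^2,\dots,\tilde\gamma_p^2)$ is deterministic ($\tilde\gamma_j=\tilde\gamma_j^{(n)}$). The variables $\beta_\ast,X_n,\varepsilon_n,\tilde x,\tilde\varepsilon$ are mutually independent. The empirical predictive risk is $$\hat r_\lambda^{test}(X_n)=\mathbb{E}[(\tilde y-\tilde x^\top\hat\theta_\lambda)^2\mid X_n].$$ Its deterministic equivalent is $$r_\lambda^{test}(X_n)=\sigma^2+\frac{\sigma^2}{n}\operatorname{Tr}[\widetilde S_pT_p(-\lambda)]+\lambda\Bigl(\frac{\lambda\alpha^2}{p}-\frac{\sigma^2}{n}\Bigr)\operatorname{Tr}[\widetilde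 S_pT_p'(-\lambda)],$$ where $T_p'$ is the derivative of $T_p$ in $z$ and $T_p$ is defined as follows. Let $D_i=\operatorname{diag}(\gamma_{i1}^2,\dots,\gamma_{ip}^2)$ and $\widetilde D_j=\operatorname{diag}(\gamma_{1j}^2,\dots,\gamma_{nj}^2)$. For $z\in\mathbb{C}\setminus\mathbb{R}^+$ ($\mathbb{R}^+=[0,\infty)$), the diagonal matrices $T_p(z)=\operatorname{diag}(T_p^{(j)}(z))_{1\le j\le p}$ and $\widetilde T_n(z)=\operatorname{diag}(\widetilde T_n^{(i)}(z))_{1\le i\le n}$ are the unique solution of $$T_p^{(j)}(z)=\frac{-1}{z\bigl(1+\frac1n\operatorname{Tr}[\widetilde D_j\widetilde T_n(z)]\bigr)},\qquad \widetilde T_n^{(i)}(z)=\frac{-1}{z\bigl(1+\frac1n\operatorname{Tr}[D_iT_p(z)]\bigr)},$$ in the class where every entry is the Stieltjes transform $z\mapsto\int\frac{\mu(dt)}{t-z}$ of a probability measure $\mu$ on $[0,\infty)$. *)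

theory Defs
  imports
    "HOL-Probability.Probability"
    "HOL-Complex_Analysis.Complex_Analysis"
    "Jordan_Normal_Form.Gauss_Jordan_Elimination"
begin

(* Since n and p = p(n) vary inside the statement, matrices and vectors are the variable-dimension
   ones of Jordan_Normal_Form. Indices start at 0, so an index set {1..n} is rendered as {..<n}. *)

definition mat_trace :: "'b :: comm_monoid_add Matrix.mat \<Rightarrow> 'b" where
  "mat_trace A = (\<Sum>i<dim_row A. A $$ (i, i))"

definition design_mat ::
  "nat \<Rightarrow> nat \<Rightarrow> (nat \<Rightarrow> nat \<Rightarrow> real) \<Rightarrow> (nat \<Rightarrow> nat \<Rightarrow> 'a \<Rightarrow> real) \<Rightarrow> 'a \<Rightarrow> real Matrix.mat" where
  "design_mat n p \<gamma> Z \<omega> = Matrix.mat n p (\<lambda>(i, j). \<gamma> i j * Z i j \<omega>)"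

definition test_cov :: "nat \<Rightarrow> (nat \<Rightarrow> real) \<Rightarrow> real Matrix.mat" where
  "test_cov p \<gamma>t = mat_diag p (\<lambda>j. (\<gamma>t j)\<^sup>2)"

(* The positive semidefinite square root of a nonnegative diagonal matrix is taken entrywise. *)
definition test_point ::
  "nat \<Rightarrow> (nat \<Rightarrow> real) \<Rightarrow> (nat \<Rightarrow> 'a \<Rightarrow> real) \<Rightarrow> 'a \<Rightarrow> real Matrix.vec" where
  "test_point p \<gamma>t zt \<omega> =
     mat_diag p (\<lambda>j. sqrt ((\<gamma>t j)\<^sup>2)) *\<^sub>v Matrix.vec p (\<lambda>j. zt j \<omega>)"

definition ridge :: "real Matrix.mat \<Rightarrow> real Matrix.vec \<Rightarrow> real \<Rightarrow> real Matrix.vec" where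
  "ridge X Y l =
     the (mat_inverse (X\<^sup>T * X + (real (dim_row X) * l) \<cdot>\<^sub>m 1\<^sub>m (dim_col X))) *\<^sub>v (X\<^sup>T *\<^sub>v Y)"

definition response ::
  "nat \<Rightarrow> nat \<Rightarrow> (nat \<Rightarrow> nat \<Rightarrow> real) \<Rightarrow> (nat \<Rightarrow> nat \<Rightarrow> 'a \<Rightarrow> real) \<Rightarrow> (nat \<Rightarrow> 'a \<Rightarrow> real) \<Rightarrow>
   (nat \<Rightarrow> 'a \<Rightarrow> real) \<Rightarrow> 'a \<Rightarrow> real Matrix.vec" where
  "response n p \<gamma> Z \<beta> eps \<omega> =
     design_mat n p \<gamma> Z \<omega> *\<^sub>v Matrix.vec p (\<lambda>j. \<beta> j \<omega>) + Matrix.vec n (\<lambda>i. eps i \<omega>)"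

definition test_response ::
  "nat \<Rightarrow> (nat \<Rightarrow> real) \<Rightarrow> (nat \<Rightarrow> 'a \<Rightarrow> real) \<Rightarrow> (nat \<Rightarrow> 'a \<Rightarrow> real) \<Rightarrow> ('a \<Rightarrow> real) \<Rightarrow> 'a \<Rightarrow> real" where
  "test_response p \<gamma>t zt \<beta> epst \<omega> =
     scalar_prod (test_point p \<gamma>t zt \<omega>) (Matrix.vec p (\<lambda>j. \<beta> j \<omega>)) + epst \<omega>"

definition gen_algebra :: "'a measure \<Rightarrow> 'i set \<Rightarrow> ('i \<Rightarrow> 'a \<Rightarrow> real) \<Rightarrow> 'a measure" where
  "gen_algebra M I V =
     vimage_algebra (space M) (\<lambda>\<omega>. \<lambda>i\<in>I. V i \<omega>) (\<Pi>\<^sub>M i\<in>I. borel)"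

definition design_algebra ::
  "'a measure \<Rightarrow> nat \<Rightarrow> nat \<Rightarrow> (nat \<Rightarrow> nat \<Rightarrow> real) \<Rightarrow> (nat \<Rightarrow> nat \<Rightarrow> 'a \<Rightarrow> real) \<Rightarrow> 'a measure" where
  "design_algebra M n p \<gamma> Z =
     gen_algebra M ({..<n} \<times> {..<p}) (\<lambda>ij \<omega>. design_mat n p \<gamma> Z \<omega> $$ ij)"

(* As a conditional expectation this is a random variable determined only almost surely. *)
definition emp_risk ::
  "'a measure \<Rightarrow> nat \<Rightarrow> nat \<Rightarrow> (nat \<Rightarrow> nat \<Rightarrow> real) \<Rightarrow> (nat \<Rightarrow> real) \<Rightarrow>
   (nat \<Rightarrow> nat \<Rightarrow> 'a \<Rightarrow> real) \<Rightarrow> (nat \<Rightarrow> 'a \<Rightarrow> real) \<Rightarrow> (nat \<Rightarrow> 'a \<Rightarrow> real) \<Rightarrow>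
   (nat \<Rightarrow> 'a \<Rightarrow> real) \<Rightarrow> ('a \<Rightarrow> real) \<Rightarrow> real \<Rightarrow> 'a \<Rightarrow> real" where
  "emp_risk M n p \<gamma> \<gamma>t Z zt \<beta> eps epst l =
     real_cond_exp M (design_algebra M n p \<gamma> Z)
       (\<lambda>\<omega>. (test_response p \<gamma>t zt \<beta> epst \<omega>
              - scalar_prod (test_point p \<gamma>t zt \<omega>)
                  (ridge (design_mat n p \<gamma> Z \<omega>) (response n p \<gamma> Z \<beta> eps \<omega>) l))\<^sup>2)"

definition iid_centered :: "'a measure \<Rightarrow> 'i set \<Rightarrow> ('i \<Rightarrow> 'a \<Rightarrow> real) \<Rightarrow> real \<Rightarrow> bool" where
  "iid_centered M I V v \<longleftrightarrow>
     prob_space.indep_vars M (\<lambda>_. borel) V I \<and>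
     (\<forall>i\<in>I. \<forall>k\<in>I. distr M borel (V i) = distr M borel (V k)) \<and>
     (\<forall>i\<in>I. integrable M (V i) \<and> integral\<^sup>L M (V i) = 0 \<and>
            integrable M (\<lambda>\<omega>. (V i \<omega>)\<^sup>2) \<and> integral\<^sup>L M (\<lambda>\<omega>. (V i \<omega>)\<^sup>2) = v)"

locale ridge_model = prob_space M for M :: "'a measure" +
  fixes n p :: nat
    and \<gamma> :: "nat \<Rightarrow> nat \<Rightarrow> real" and \<gamma>t :: "nat \<Rightarrow> real"
    and Z :: "nat \<Rightarrow> nat \<Rightarrow> 'a \<Rightarrow> real" and zt :: "nat \<Rightarrow> 'a \<Rightarrow> real"
    and \<beta> :: "nat \<Rightarrow> 'a \<Rightarrow> real" and eps :: "nat \<Rightarrow> 'a \<Rightarrow> real" and epst :: "'a \<Rightarrow> real"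
    and \<sigma> :: real
  assumes Z: "iid_centered M ({..<n} \<times> {..<p}) (\<lambda>(i, j). Z i j) 1"
    and zt: "iid_centered M {..<p} zt 1"
    and \<beta>: "\<And>j. j < p \<Longrightarrow> \<beta> j \<in> borel_measurable M"
    and eps: "iid_centered M {..<n} eps (\<sigma>\<^sup>2)"
    and epst: "epst \<in> borel_measurable M"
      "integrable M epst" "expectation epst = 0"
      "integrable M (\<lambda>\<omega>. (epst \<omega>)\<^sup>2)" "expectation (\<lambda>\<omega>. (epst \<omega>)\<^sup>2) = \<sigma>\<^sup>2"
    and mutually_indep:
      "indep_sets (\<lambda>k. sets (
         [gen_algebra M {..<p} \<beta>,
          design_algebra M n p \<gamma> Z,
          gen_algebra M {..<n} eps,
          gen_algebra M {..<p} (\<lambda>j \<omega>. vec_index (test_point p \<gamma>t zt \<omega>) j),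
          vimage_algebra (space M) epst borel] ! k)) {..<5}"

definition stieltjes_transform_nonneg :: "(complex \<Rightarrow> complex) \<Rightarrow> bool" where
  "stieltjes_transform_nonneg f \<longleftrightarrow>
     (\<exists>\<mu> :: real measure. prob_space \<mu> \<and> sets \<mu> = sets borel \<and> (AE t in \<mu>. 0 \<le> t) \<and>
        (\<forall>z. z \<notin> \<real>\<^sub>\<ge>\<^sub>0 \<longrightarrow> f z = (LINT t|\<mu>. 1 / (complex_of_real t - z))))"

(* T j and Tt i are the diagonal entries of the matrices T_p and (T tilde)_n. The system has exactly
   one solution in this class, as far as values off [0, oo) are concerned; values on [0, oo) are
   left unconstrained. The denominators vanish nowhere off [0, oo), because Stieltjes transforms of
   probability measures on [0, oo) have no zeros there. *)
definition canonical_solution ::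
  "nat \<Rightarrow> nat \<Rightarrow> (nat \<Rightarrow> nat \<Rightarrow> real) \<Rightarrow> (nat \<Rightarrow> complex \<Rightarrow> complex) \<Rightarrow> (nat \<Rightarrow> complex \<Rightarrow> complex) \<Rightarrow> bool" where
  "canonical_solution n p \<gamma> T Tt \<longleftrightarrow>
     (\<forall>j<p. stieltjes_transform_nonneg (T j)) \<and>
     (\<forall>i<n. stieltjes_transform_nonneg (Tt i)) \<and>
     (\<forall>z. z \<notin> \<real>\<^sub>\<ge>\<^sub>0 \<longrightarrow>
        (\<forall>j<p. T j z = - 1 / (z * (1 + 1 / of_nat n *
           mat_trace (mat_diag n (\<lambda>i. complex_of_real ((\<gamma> i j)\<^sup>2)) * mat_diag n (\<lambda>i. Tt i z))))) \<and>
        (\<forall>i<n. Tt i z = - 1 / (z * (1 + 1 / of_nat n *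
           mat_trace (mat_diag p (\<lambda>j. complex_of_real ((\<gamma> i j)\<^sup>2)) * mat_diag p (\<lambda>j. T j z))))))"

(* Both traces are real, since a Stieltjes transform of a measure on [0, oo) and its derivative are
   real at -l < 0; Re only changes the type. *)
definition det_risk ::
  "nat \<Rightarrow> nat \<Rightarrow> (nat \<Rightarrow> real) \<Rightarrow> (nat \<Rightarrow> complex \<Rightarrow> complex) \<Rightarrow> real \<Rightarrow> real \<Rightarrow> real \<Rightarrow> real" where
  "det_risk n p \<gamma>t T \<sigma> \<alpha> l =
     \<sigma>\<^sup>2
     + \<sigma>\<^sup>2 / real n *
         Re (mat_trace (map_mat complex_of_real (test_cov p \<gamma>t) *
                        mat_diag p (\<lambda>j. T j (- complex_of_real l))))
     + l * (l * \<alpha>\<^sup>2 / real p - \<sigma>\<^sup>2 / real n) *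
         Re (mat_trace (map_mat complex_of_real (test_cov p \<gamma>t) *
                        mat_diag p (\<lambda>j. deriv (T j) (- complex_of_real l))))"

end

theory Submission
  imports Defs "Jordan_Normal_Form.Determinant"
begin

text \<open>
  Let \<open>c = n l\<close> and let \<open>r\<close> be the \<open>j\<close>-th row of \<open>(X\<^sup>T X + c I)\<^sup>-\<^sup>1\<close>. The \<open>j\<close>-th coordinate of the estimation
  error is \<open>c (r \<cdot> \<beta>) - (X r) \<cdot> \<epsilon>\<close>. The test point, \<open>\<beta>\<close> and \<open>\<epsilon>\<close> have uncorrelated coordinates and are
  independent of \<open>X\<close>, so the conditional risk is \<open>\<sigma>\<^sup>2\<close> plus a nonnegative combination of the terms
  \<open>(\<alpha>\<^sup>2 / p) c\<^sup>2 |r|\<^sup>2 + \<sigma>\<^sup>2 |X r|\<^sup>2\<close>. Since \<open>c r = e - X\<^sup>T X r\<close> for the \<open>j\<close>-th unit vector \<open>e\<close>, each term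
  is a convex quadratic functional of \<open>r\<close>, whose minimiser is the row belonging to \<open>c = \<sigma>\<^sup>2 p / \<alpha>\<^sup>2\<close>.

  For the deterministic equivalent, write the entry \<open>T j\<close> as the Stieltjes transform of \<open>\<mu>\<close>. Its
  contribution is the integral against \<open>\<mu>(dt)\<close> of \<open>(a t + b l\<^sup>2) / (t + l)\<^sup>2\<close> with \<open>a = \<sigma>\<^sup>2 / n\<close> and
  \<open>b = \<alpha>\<^sup>2 / p\<close>, and the integrand is least at \<open>l = a / b\<close> for every \<open>t \<ge> 0\<close>.
\<close>

subsection \<open>Stieltjes transforms and the deterministic equivalent\<close>

text \<open>The point \<open>-l\<close> has distance \<open>t + l\<close> from \<open>t\<close>, and
  moving by less than \<open>l / 2\<close> still leaves at least \<open>l / 2\<close>. The bound is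
  uniform in \<open>t \<ge> 0\<close> and carries both integrability and differentiation of the
  transform.\<close>

lemma stieltjes_kernel_bound:
  fixes z :: complex and t l :: real
  assumes "0 \<le> t" "0 < l" "dist z (- complex_of_real l) < l / 2"
  shows "l / 2 \<le> cmod (complex_of_real t - z)"
proof -
  have "t + l = cmod (complex_of_real t + complex_of_real l)"
    using assms by (simp flip: of_real_add)
  also have "\<dots> \<le> cmod (complex_of_real t - z) + cmod (z - (- complex_of_real l))"
    using norm_triangle_ineq[of "complex_of_real t - z" "z + complex_of_real l"] by simp
  finally show ?thesis
    using assms by (simp add: dist_norm)
qed

text \<open>Bounded functions are integrable against a probability measure. The product kernel is
  included because it is the difference quotient of \<open>1 / (t - z)\<close> between
  \<open>z\<close> and \<open>w\<close>.\<close>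

lemma stieltjes_kernel_integrable:
  fixes \<mu> :: "real measure"
  assumes "prob_space \<mu>" "sets \<mu> = sets borel" "AE t in \<mu>. 0 \<le> t" "0 < l"
    and "dist z (- complex_of_real l) < l / 2" "dist w (- complex_of_real l) < l / 2"
  shows "integrable \<mu> (\<lambda>t. 1 / (complex_of_real t - z))"
    and "integrable \<mu> (\<lambda>t. 1 / ((complex_of_real t - z) * (complex_of_real t - w)))"
proof -
  interpret prob_space \<mu> by fact
  have [measurable_cong]: "sets \<mu> = sets borel" by fact
  have inv: "AE t in \<mu>. norm (1 / (complex_of_real t - y)) \<le> 2 / l"
    if "dist y (- complex_of_real l) < l / 2" for y
    using assms(3)
  proof eventually_elim
    case (elim t)
    have "l / 2 \<le> cmod (complex_of_real t - y)"
      by (rule stieltjes_kernel_bound[OF elim assms(4) that])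
    then have "1 / cmod (complex_of_real t - y) \<le> 1 / (l / 2)"
      using assms(4) by (intro frac_le) auto
    then show ?case by (simp add: norm_divide)
  qed
  show "integrable \<mu> (\<lambda>t. 1 / (complex_of_real t - z))"
    by (rule integrable_const_bound[OF inv[OF assms(5)]]) measurable
  have "AE t in \<mu>. norm (1 / ((complex_of_real t - z) * (complex_of_real t - w))) \<le> 2 / l * (2 / l)"
    using inv[OF assms(5)] inv[OF assms(6)]
  proof eventually_elim
    case (elim t)
    have "norm (1 / (complex_of_real t - z)) * norm (1 / (complex_of_real t - w)) \<le> 2 / l * (2 / l)"
      using elim assms(4) by (intro mult_mono) auto
    then show ?case by (simp add: norm_divide norm_mult)
  qed
  then show "integrable \<mu> (\<lambda>t. 1 / ((complex_of_real t - z) * (complex_of_real t - w)))"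
    by (rule integrable_const_bound) measurable
qed

text \<open>Differentiation under the integral with an explicit error: the difference quotient
  misses the derivative by the integral of \<open>(z - w) / ((t - z) (t - w)^2)\<close>, whose
  modulus is at most \<open>8 / l ^ 3 * norm (z - w)\<close>, the three factors \<open>l / 2\<close>
  coming from the kernel bound.\<close>

lemma stieltjes_has_field_derivative:
  fixes \<mu> :: "real measure" and f :: "complex \<Rightarrow> complex"
  assumes \<mu>: "prob_space \<mu>" "sets \<mu> = sets borel" "AE t in \<mu>. 0 \<le> t"
    and f: "\<And>z. z \<notin> \<real>\<^sub>\<ge>\<^sub>0 \<Longrightarrow> f z = (LINT t|\<mu>. 1 / (complex_of_real t - z))"
    and l: "0 < l"
  shows "(f has_field_derivative (LINT t|\<mu>. 1 / (complex_of_real t + complex_of_real l)\<^sup>2))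
           (at (- complex_of_real l))"
proof -
  interpret prob_space \<mu> by fact
  have [measurable_cong]: "sets \<mu> = sets borel" by fact
  define w where "w = - complex_of_real l"
  define D where "D = (LINT t|\<mu>. 1 / ((complex_of_real t - w) * (complex_of_real t - w)))"
  have w: "dist w (- complex_of_real l) < l / 2" using l by (simp add: w_def)
  \<comment> \<open>The function \<open>f\<close> is known as an integral only off the nonnegative
    axis, so the disc has to avoid that axis. A real \<open>t \<ge> 0\<close> in the disc would
    contradict the kernel bound at \<open>z = t\<close>.\<close>
  have off: "z \<notin> \<real>\<^sub>\<ge>\<^sub>0" if "dist z w < l / 2" for z
  proof
    assume "z \<in> \<real>\<^sub>\<ge>\<^sub>0"
    then obtain t where "z = complex_of_real t" "0 \<le> t" by (auto simp: nonneg_Reals_def)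
    with that l stieltjes_kernel_bound[of t l z] show False by (auto simp: w_def)
  qed
  have int: "integrable \<mu> (\<lambda>t. 1 / (complex_of_real t - z))"
    "integrable \<mu> (\<lambda>t. 1 / ((complex_of_real t - z) * (complex_of_real t - w)))"
    if "dist z w < l / 2" for z
    using stieltjes_kernel_integrable[OF \<mu> l _ w, of z] that by (auto simp: w_def)
  have AE_bounds: "AE t in \<mu>. l / 2 \<le> cmod (complex_of_real t - z)" if "dist z w < l / 2" for z
    using \<mu>(3) by eventually_elim (use stieltjes_kernel_bound[of _ l z] that l in \<open>simp add: w_def\<close>)
  have bound: "norm ((f z - f w) / (z - w) - D) \<le> 8 / l ^ 3 * norm (z - w)"
    if z: "dist z w < l / 2" and "z \<noteq> w" for z
  proof -
    let ?k = "\<lambda>t. 1 / ((complex_of_real t - z) * (complex_of_real t - w))"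
    let ?k' = "\<lambda>t. 1 / ((complex_of_real t - w) * (complex_of_real t - w))"
    have zero: "dist w w < l / 2" using l by simp
    have "f z - f w = (LINT t|\<mu>. 1 / (complex_of_real t - z) - 1 / (complex_of_real t - w))"
      using z l by (simp add: f off int)
    also have "\<dots> = (LINT t|\<mu>. (z - w) * ?k t)"
    proof (rule integral_cong_AE)
      show "AE t in \<mu>. 1 / (complex_of_real t - z) - 1 / (complex_of_real t - w) = (z - w) * ?k t"
        using AE_bounds[OF z] AE_bounds[OF zero]
      proof eventually_elim
        case (elim t)
        then have "complex_of_real t - z \<noteq> 0" "complex_of_real t - w \<noteq> 0" using l by force+
        then show ?case by (simp add: field_simps)
      qed
    qed measurable
    finally have "(f z - f w) / (z - w) = (LINT t|\<mu>. ?k t)"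
      using \<open>z \<noteq> w\<close> by (simp del: times_divide_eq_right)
    then have "(f z - f w) / (z - w) - D = (LINT t|\<mu>. ?k t - ?k' t)"
      using int[OF z] int[OF zero] by (simp add: D_def)
    also have "norm \<dots> \<le> (LINT t|\<mu>. 8 / l ^ 3 * norm (z - w))"
    proof (rule order_trans[OF integral_norm_bound integral_mono_AE])
      show "integrable \<mu> (\<lambda>t. norm (?k t - ?k' t))"
        using int[OF z] int[OF zero] by (intro integrable_norm) simp
      show "AE t in \<mu>. norm (?k t - ?k' t) \<le> 8 / l ^ 3 * norm (z - w)"
        using AE_bounds[OF z] AE_bounds[OF zero]
      proof eventually_elim
        case (elim t)
        let ?a = "complex_of_real t - z" and ?b = "complex_of_real t - w"
        have nz: "?a \<noteq> 0" "?b \<noteq> 0" using elim l by force+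
        have "1 / (a * b) - 1 / (b * b) = (b - a) / (a * (b * b))" if "a \<noteq> 0" "b \<noteq> 0" for a b :: complex
          using that by (simp add: field_simps)
        from this[OF nz] have "?k t - ?k' t = (z - w) / (?a * (?b * ?b))" by simp
        then have "norm (?k t - ?k' t) = norm (z - w) / (norm ?a * (norm ?b * norm ?b))"
          by (simp add: norm_divide norm_mult)
        also have "\<dots> \<le> norm (z - w) / (l / 2 * (l / 2 * (l / 2)))"
          using elim l by (intro divide_left_mono mult_mono mult_pos_pos) (auto simp: nz)
        finally show ?case by (simp add: field_simps power3_eq_cube)
      qed
    qed simp
    finally show ?thesis by (simp add: prob_space)
  qed
  have "((\<lambda>z. (f z - f w) / (z - w) - D) \<longlongrightarrow> 0) (at w)"
  proof (rule Lim_null_comparison)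
    show "\<forall>\<^sub>F z in at w. norm ((f z - f w) / (z - w) - D) \<le> 8 / l ^ 3 * norm (z - w)"
      using bound l by (auto simp: eventually_at intro!: exI[of _ "l / 2"])
    show "((\<lambda>z. 8 / l ^ 3 * norm (z - w)) \<longlongrightarrow> 0) (at w)"
      using l by (auto intro!: tendsto_eq_intros)
  qed
  then have "(f has_field_derivative D) (at w)"
    by (simp add: has_field_derivative_iff LIM_zero_iff)
  then show ?thesis by (simp add: D_def w_def power2_eq_square)
qed

text \<open>At \<open>l0\<close> the second summand vanishes because \<open>l0 * b = a\<close>. Over
  a common denominator, the excess at \<open>l\<close> has the numerator
  \<open>b * t * (l - l0)^2\<close>.\<close>

lemma ridge_scalar_minimum:
  fixes a b l t :: real
  assumes "0 < a" "0 < b" "0 < l" "0 \<le> t"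
  defines "l0 \<equiv> a / b"
  shows "a * (1 / (t + l0)) + l0 * (l0 * b - a) * (1 / (t + l0)\<^sup>2)
           \<le> a * (1 / (t + l)) + l * (l * b - a) * (1 / (t + l)\<^sup>2)"
proof -
  have a: "a = b * l0" and l0: "0 < l0" using assms by (auto simp: l0_def)
  have "a * (1 / (t + l)) + l * (l * b - a) * (1 / (t + l)\<^sup>2)
          - (a * (1 / (t + l0)) + l0 * (l0 * b - a) * (1 / (t + l0)\<^sup>2))
        = b * (t * (l - l0)\<^sup>2 / ((t + l)\<^sup>2 * (t + l0)))"
    unfolding a using assms(3,4) l0
    by (simp add: divide_simps add_pos_pos add_nonneg_pos power2_eq_square) (auto simp: algebra_simps)
  also have "\<dots> \<ge> 0" using assms l0 by simp
  finally show ?thesis by simp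
qed

lemma mat_trace_mult_diag:
  assumes "A \<in> carrier_mat p p"
  shows "mat_trace (A * mat_diag p f) = (\<Sum>j<p. A $$ (j, j) * f j)"
  using assms by (simp add: mat_trace_def mat_diag_mult_right[OF assms])

text \<open>The kernels are real at \<open>-l\<close>, so the transform and its derivative are there
  the integrals of \<open>1 / (t + l)\<close> and \<open>1 / (t + l)^2\<close>. The minimiser
  \<open>a / b\<close> of the combined integrand does not depend on \<open>t\<close>, hence the
  pointwise inequality integrates.\<close>

lemma stieltjes_risk_minimum:
  fixes f :: "complex \<Rightarrow> complex" and a b l :: real
  assumes f: "stieltjes_transform_nonneg f" and pos: "0 < a" "0 < b" "0 < l"
  defines "risk \<equiv> \<lambda>l. a * Re (f (- complex_of_real l))
                        + l * (l * b - a) * Re (deriv f (- complex_of_real l))"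
  shows "risk (a / b) \<le> risk l"
proof -
  obtain \<mu> :: "real measure" where \<mu>: "prob_space \<mu>" "sets \<mu> = sets borel" "AE t in \<mu>. 0 \<le> t"
    and f: "\<And>z. z \<notin> \<real>\<^sub>\<ge>\<^sub>0 \<Longrightarrow> f z = (LINT t|\<mu>. 1 / (complex_of_real t - z))"
    using f unfolding stieltjes_transform_nonneg_def by blast
  have ints: "integrable \<mu> (\<lambda>t. 1 / (t + l))" "integrable \<mu> (\<lambda>t. 1 / (t + l)\<^sup>2)"
    and vals: "Re (f (- complex_of_real l)) = (LINT t|\<mu>. 1 / (t + l))"
      "Re (deriv f (- complex_of_real l)) = (LINT t|\<mu>. 1 / (t + l)\<^sup>2)" if l: "0 < l" for l
  proof -
    have d: "dist (- complex_of_real l) (- complex_of_real l) < l / 2" using l by simp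
    have k: "1 / (complex_of_real t - - complex_of_real l) = complex_of_real (1 / (t + l))"
      "1 / ((complex_of_real t - - complex_of_real l) * (complex_of_real t - - complex_of_real l))
         = complex_of_real (1 / (t + l)\<^sup>2)" for t
      by (simp_all add: power2_eq_square)
    note K = stieltjes_kernel_integrable[OF \<mu> l d d, unfolded k]
    show "integrable \<mu> (\<lambda>t. 1 / (t + l))" "integrable \<mu> (\<lambda>t. 1 / (t + l)\<^sup>2)"
      using K by (simp_all only: complex_of_real_integrable_eq)
    have "- complex_of_real l \<notin> \<real>\<^sub>\<ge>\<^sub>0"
      using l by (simp add: complex_nonneg_Reals_iff)
    from f[OF this] show "Re (f (- complex_of_real l)) = (LINT t|\<mu>. 1 / (t + l))"
      by (simp only: k integral_complex_of_real Re_complex_of_real)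
    have "deriv f (- complex_of_real l)
            = (LINT t|\<mu>. 1 / (complex_of_real t + complex_of_real l)\<^sup>2)"
      by (rule DERIV_imp_deriv) (rule stieltjes_has_field_derivative[OF \<mu> f l])
    also have "\<dots> = (LINT t|\<mu>. complex_of_real (1 / (t + l)\<^sup>2))" by simp
    finally show "Re (deriv f (- complex_of_real l)) = (LINT t|\<mu>. 1 / (t + l)\<^sup>2)"
      by (simp only: integral_complex_of_real Re_complex_of_real)
  qed
  have risk: "risk l = (LINT t|\<mu>. a * (1 / (t + l)) + l * (l * b - a) * (1 / (t + l)\<^sup>2))"
    and risk_int: "integrable \<mu> (\<lambda>t. a * (1 / (t + l)) + l * (l * b - a) * (1 / (t + l)\<^sup>2))"
    if "0 < l" for l
    unfolding risk_def vals[OF that] using ints[OF that]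
    by (simp_all del: times_divide_eq_right)
  have l0: "0 < a / b" using pos by simp
  show ?thesis unfolding risk[OF l0] risk[OF pos(3)]
  proof (intro integral_mono_AE risk_int l0 pos(3))
    show "AE t in \<mu>. a * (1 / (t + a / b)) + a / b * (a / b * b - a) * (1 / (t + a / b)\<^sup>2)
            \<le> a * (1 / (t + l)) + l * (l * b - a) * (1 / (t + l)\<^sup>2)"
      using \<mu>(3) by eventually_elim (rule ridge_scalar_minimum[OF pos])
  qed
qed

text \<open>Up to the constant \<open>\<sigma>\<^sup>2\<close>, the risk is a sum of contributions
  of single transforms with weights \<open>(\<gamma>t j)\<^sup>2\<close>. The constants
  \<open>a\<close> and \<open>b\<close> are common to all \<open>j\<close>, so one value of
  \<open>l\<close> minimises every summand.\<close>

lemma det_risk_minimum: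
  assumes T: "\<And>j. j < p \<Longrightarrow> stieltjes_transform_nonneg (T j)"
    and pos: "0 < \<sigma>\<^sup>2" "0 < \<alpha>" "0 < n" "0 < p" "0 < l"
  shows "det_risk n p \<gamma>t T \<sigma> \<alpha> (\<sigma>\<^sup>2 * real p / (\<alpha>\<^sup>2 * real n)) \<le> det_risk n p \<gamma>t T \<sigma> \<alpha> l"
proof -
  define a b where "a = \<sigma>\<^sup>2 / real n" and "b = \<alpha>\<^sup>2 / real p"
  have ab: "0 < a" "0 < b" and l0: "\<sigma>\<^sup>2 * real p / (\<alpha>\<^sup>2 * real n) = a / b"
    using pos by (simp_all add: a_def b_def)
  have carrier: "map_mat complex_of_real (test_cov p \<gamma>t) \<in> carrier_mat p p"
    by (simp add: test_cov_def)
  have entry: "map_mat complex_of_real (test_cov p \<gamma>t) $$ (j, j) = complex_of_real ((\<gamma>t j)\<^sup>2)"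
    if "j < p" for j
    using that by (simp add: test_cov_def mat_diag_def)
  have det_risk: "det_risk n p \<gamma>t T \<sigma> \<alpha> l = \<sigma>\<^sup>2 + (\<Sum>j<p. (\<gamma>t j)\<^sup>2 *
      (a * Re (T j (- complex_of_real l)) + l * (l * b - a) * Re (deriv (T j) (- complex_of_real l))))" for l
    unfolding det_risk_def mat_trace_mult_diag[OF carrier]
    by (simp add: entry a_def b_def sum_distrib_left sum_distrib_right distrib_left sum.distrib mult_ac
        del: of_real_power)
  show ?thesis unfolding det_risk l0
    using T ab pos(5) by (intro add_left_mono sum_mono mult_left_mono stieltjes_risk_minimum) auto
qed

subsection \<open>Linear algebra of the ridge estimator\<close>

text \<open>The parameter \<open>c\<close> stands for \<open>n * l\<close> in the estimator. The
  value \<open>c = 0\<close> is also used, to express \<open>X\<^sup>T * X\<close> when two rows are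
  compared.\<close>

definition ridge_gram :: "real Matrix.mat \<Rightarrow> real \<Rightarrow> real Matrix.mat" where
  "ridge_gram X c = X\<^sup>T * X + c \<cdot>\<^sub>m 1\<^sub>m (dim_col X)"

lemma ridge_gram_carrier: "X \<in> carrier_mat n p \<Longrightarrow> ridge_gram X c \<in> carrier_mat p p"
  by (auto simp: ridge_gram_def)

lemma scalar_prod_self_sum: "scalar_prod v v = (\<Sum>i<dim_vec v. (vec_index v i)\<^sup>2)"
  for v :: "real Matrix.vec"
  by (simp add: scalar_prod_def power2_eq_square atLeast0LessThan)

lemma scalar_prod_transpose_mult_vec:
  fixes X :: "real Matrix.mat"
  assumes "X \<in> carrier_mat n p" "w \<in> carrier_vec p" "y \<in> carrier_vec n"
  shows "scalar_prod w (X\<^sup>T *\<^sub>v y) = scalar_prod (X *\<^sub>v w) y"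
proof -
  have "scalar_prod w (X\<^sup>T *\<^sub>v y) = scalar_prod (X\<^sup>T *\<^sub>v y) w"
    using assms by (intro comm_scalar_prod[of _ p]) auto
  also have "\<dots> = scalar_prod y (X *\<^sub>v w)"
    by (rule transpose_vec_mult_scalar[OF assms])
  also have "\<dots> = scalar_prod (X *\<^sub>v w) y"
    using assms by (intro comm_scalar_prod[of _ n]) auto
  finally show ?thesis .
qed

lemma ridge_gram_mult_vec:
  assumes "X \<in> carrier_mat n p" "v \<in> carrier_vec p"
  shows "ridge_gram X c *\<^sub>v v = X\<^sup>T *\<^sub>v (X *\<^sub>v v) + c \<cdot>\<^sub>v v"
proof -
  have "ridge_gram X c *\<^sub>v v = (X\<^sup>T * X) *\<^sub>v v + (c \<cdot>\<^sub>m 1\<^sub>m p) *\<^sub>v v"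
    unfolding ridge_gram_def using assms by (subst add_mult_distrib_mat_vec[of _ p p]) auto
  also have "(X\<^sup>T * X) *\<^sub>v v = X\<^sup>T *\<^sub>v (X *\<^sub>v v)"
    using assms by (intro assoc_mult_mat_vec[of _ p n _ p]) auto
  also have "(c \<cdot>\<^sub>m 1\<^sub>m p) *\<^sub>v v = c \<cdot>\<^sub>v v"
    using assms by (intro eq_vecI) (auto simp: scalar_prod_left_unit)
  finally show ?thesis .
qed

text \<open>This bilinear form is the source of invertibility, of the bounds on the rows of the
  inverse, of the error formula and of the cross term in the comparison of rows.\<close>

lemma scalar_prod_ridge_gram:
  assumes X: "X \<in> carrier_mat n p" and v: "v \<in> carrier_vec p" and w: "w \<in> carrier_vec p"
  shows "scalar_prod w (ridge_gram X c *\<^sub>v v)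
           = scalar_prod (X *\<^sub>v w) (X *\<^sub>v v) + c * scalar_prod w v"
proof -
  have "X *\<^sub>v v \<in> carrier_vec n" "X\<^sup>T *\<^sub>v (X *\<^sub>v v) \<in> carrier_vec p" using X v by auto
  then show ?thesis
    using v w by (simp add: ridge_gram_mult_vec[OF X v] scalar_prod_add_distrib[of _ p]
        scalar_prod_transpose_mult_vec[OF X w])
qed

text \<open>A vector \<open>v\<close> in the kernel would satisfy
  \<open>|X v|^2 + c |v|^2 = 0\<close>, which forces \<open>v = 0\<close> since
  \<open>c > 0\<close>.\<close>

lemma det_ridge_gram_nonzero:
  assumes X: "X \<in> carrier_mat n p" and c: "0 < c"
  shows "Determinant.det (ridge_gram X c) \<noteq> 0"
proof
  have A: "ridge_gram X c \<in> carrier_mat p p" using X by (rule ridge_gram_carrier)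
  assume "Determinant.det (ridge_gram X c) = 0"
  then obtain v where v: "v \<in> carrier_vec p" "v \<noteq> 0\<^sub>v p" "ridge_gram X c *\<^sub>v v = 0\<^sub>v p"
    using det_0_iff_vec_prod_zero_field[OF A] by blast
  have "scalar_prod (X *\<^sub>v v) (X *\<^sub>v v) + c * scalar_prod v v = 0"
    using scalar_prod_ridge_gram[OF X v(1) v(1), of c] v by simp
  moreover have "0 \<le> scalar_prod (X *\<^sub>v v) (X *\<^sub>v v)" "0 \<le> scalar_prod v v"
    unfolding scalar_prod_self_sum by (simp_all add: sum_nonneg)
  ultimately have "scalar_prod v v = 0"
    using c by (smt (verit) mult_nonneg_nonneg mult_pos_pos)
  then have "v = 0\<^sub>v p"
    using v(1) by (intro eq_vecI) (auto simp: scalar_prod_self_sum sum_nonneg_eq_0_iff)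
  with v show False by simp
qed

definition ridge_inverse :: "real Matrix.mat \<Rightarrow> real \<Rightarrow> real Matrix.mat" where
  "ridge_inverse X c = the (mat_inverse (ridge_gram X c))"

text \<open>The adjugate provides an explicit two-sided inverse, so \<open>mat_inverse\<close>
  succeeds and, inverses being unique, returns the same matrix. The adjugate formula is what later
  shows that the entries are measurable.\<close>

lemma ridge_inverse:
  assumes X: "X \<in> carrier_mat n p" and c: "0 < c"
  shows ridge_inverse_carrier: "ridge_inverse X c \<in> carrier_mat p p"
    and ridge_inverse_mult: "ridge_inverse X c * ridge_gram X c = 1\<^sub>m p"
    and ridge_inverse_adj: "ridge_inverse X c
      = (1 / Determinant.det (ridge_gram X c)) \<cdot>\<^sub>m adj_mat (ridge_gram X c)"
proof -
  let ?A = "ridge_gram X c"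
  define B where "B = (1 / Determinant.det ?A) \<cdot>\<^sub>m adj_mat ?A"
  have A: "?A \<in> carrier_mat p p" using X by (rule ridge_gram_carrier)
  note d = det_ridge_gram_nonzero[OF X c]
  have B: "B \<in> carrier_mat p p" using adj_mat(1)[OF A] by (simp add: B_def)
  have AB: "?A * B = 1\<^sub>m p"
    using adj_mat[OF A] d mult_smult_distrib[OF A adj_mat(1)[OF A], of "1 / Determinant.det ?A"]
    by (auto simp: B_def intro!: eq_matI)
  have BA: "B * ?A = 1\<^sub>m p"
    using adj_mat[OF A] d mult_smult_assoc_mat[OF adj_mat(1)[OF A] A, of "1 / Determinant.det ?A"]
    by (auto simp: B_def intro!: eq_matI)
  \<comment> \<open>A result \<open>None\<close> of \<open>mat_inverse\<close> would mean that the
    matrix is not a unit of the matrix ring.\<close>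
  have "?A \<in> Units (ring_mat TYPE(real) p ())"
    using A B AB BA unfolding Units_def ring_mat_def by auto
  then have "mat_inverse ?A \<noteq> None"
    using mat_inverse(1)[OF A, of "()"] by blast
  then obtain R where R: "mat_inverse ?A = Some R" by auto
  note inv = mat_inverse(2)[OF A R]
  have Req: "ridge_inverse X c = R" by (simp add: ridge_inverse_def R)
  show "ridge_inverse X c \<in> carrier_mat p p" "ridge_inverse X c * ?A = 1\<^sub>m p"
    using inv by (auto simp: Req)
  have "R = R * (?A * B)" using AB inv right_mult_one_mat[of R p p] by simp
  also have "\<dots> = (R * ?A) * B" using inv A B by (metis assoc_mult_mat)
  also have "\<dots> = B" using inv B by simp
  finally show "ridge_inverse X c = (1 / Determinant.det ?A) \<cdot>\<^sub>m adj_mat ?A"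
    by (simp add: Req B_def)
qed

text \<open>A row of the left inverse, multiplied from the left onto the Gram matrix, gives a unit
  row vector; symmetry of the Gram matrix turns this into an equation for column vectors.\<close>

lemma ridge_gram_mult_row:
  assumes X: "X \<in> carrier_mat n p" and c: "0 < c" and j: "j < p"
  shows "ridge_gram X c *\<^sub>v Matrix.row (ridge_inverse X c) j = unit_vec p j"
proof (rule eq_vecI)
  let ?A = "ridge_gram X c" and ?R = "ridge_inverse X c"
  have A: "?A \<in> carrier_mat p p" using X by (rule ridge_gram_carrier)
  note R = ridge_inverse[OF X c]
  have sym: "?A\<^sup>T = ?A"
    unfolding ridge_gram_def using X by (subst transpose_add[of _ p p]) (auto simp: transpose_mult[of _ p n _ p])
  fix a assume "a < dim_vec (unit_vec p j)"
  then have a: "a < p" by simp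
  have "vec_index (?A *\<^sub>v Matrix.row ?R j) a = scalar_prod (Matrix.row ?R j) (Matrix.row ?A a)"
    using a A R(1) j comm_scalar_prod[of "Matrix.row ?A a" p "Matrix.row ?R j"] by simp
  also have "Matrix.row ?A a = Matrix.col ?A a"
    using a A by (metis sym carrier_matD(2) row_transpose)
  also have "scalar_prod (Matrix.row ?R j) (Matrix.col ?A a) = (?R * ?A) $$ (j, a)"
    using a j A R(1) by simp
  also have "\<dots> = vec_index (unit_vec p j) a" using a j unfolding R(2) by auto
  finally show "vec_index (?A *\<^sub>v Matrix.row ?R j) a = vec_index (unit_vec p j) a" .
qed (use ridge_gram_carrier[OF X] in auto)

text \<open>The equation for \<open>r\<close> is paired with \<open>r\<close> itself.\<close>

lemma ridge_row_energy:
  assumes X: "X \<in> carrier_mat n p" and j: "j < p" and r: "r \<in> carrier_vec p"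
    and eq: "ridge_gram X c *\<^sub>v r = unit_vec p j"
  shows "(\<Sum>i<n. (vec_index (X *\<^sub>v r) i)\<^sup>2) + c * (\<Sum>a<p. (vec_index r a)\<^sup>2) = vec_index r j"
  using scalar_prod_ridge_gram[OF X r r, of c] X r j unfolding eq
  by (simp add: scalar_prod_self_sum scalar_prod_right_unit)

text \<open>The energy identity gives \<open>c * r_j^2 \<le> r_j\<close>, hence
  \<open>0 \<le> r_j \<le> 1 / c\<close>, and then \<open>|r|^2 \<le> 1 / c^2\<close> and
  \<open>|X r|^2 \<le> 1 / c\<close>. None of these bounds depends on \<open>X\<close>, so for a
  random design the coefficients of the prediction error are bounded.\<close>

lemma ridge_row_bounds:
  assumes X: "X \<in> carrier_mat n p" and j: "j < p" and r: "r \<in> carrier_vec p" and c: "0 < c"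
    and eq: "ridge_gram X c *\<^sub>v r = unit_vec p j"
  shows "a < p \<Longrightarrow> \<bar>vec_index r a\<bar> \<le> 1 / c"
    and "i < n \<Longrightarrow> \<bar>vec_index (X *\<^sub>v r) i\<bar> \<le> 1 / sqrt c"
proof -
  note E = ridge_row_energy[OF X j r eq]
  have nonneg: "0 \<le> (\<Sum>i<n. (vec_index (X *\<^sub>v r) i)\<^sup>2)" "0 \<le> (\<Sum>a<p. (vec_index r a)\<^sup>2)"
    by (simp_all add: sum_nonneg)
  have le: "(vec_index r a)\<^sup>2 \<le> (\<Sum>a<p. (vec_index r a)\<^sup>2)" if "a < p" for a
    using that by (intro member_le_sum) auto
  have rj0: "0 \<le> vec_index r j" using E nonneg c by (smt (verit) mult_nonneg_nonneg)
  have "c * (vec_index r j)\<^sup>2 \<le> vec_index r j"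
    using E nonneg mult_left_mono[OF le[OF j], of c] c by linarith
  then have "vec_index r j * (c * vec_index r j) \<le> vec_index r j * 1"
    by (simp add: power2_eq_square mult_ac)
  then have "c * vec_index r j \<le> 1"
    using rj0 by (cases "vec_index r j = 0") (auto dest: mult_left_le_imp_le)
  then have rj: "vec_index r j \<le> 1 / c" using c by (simp add: field_simps)
  show "\<bar>vec_index r a\<bar> \<le> 1 / c" if "a < p"
  proof -
    have "c * (vec_index r a)\<^sup>2 \<le> 1 / c"
      using E nonneg rj mult_left_mono[OF le[OF that], of c] c by linarith
    then have "(vec_index r a)\<^sup>2 \<le> (1 / c)\<^sup>2"
      using c by (simp add: field_simps power2_eq_square)
    then show ?thesis using c by (simp add: power2_le_iff_abs_le)
  qed
  show "\<bar>vec_index (X *\<^sub>v r) i\<bar> \<le> 1 / sqrt c" if "i < n"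
  proof -
    have "(vec_index (X *\<^sub>v r) i)\<^sup>2 \<le> (\<Sum>i<n. (vec_index (X *\<^sub>v r) i)\<^sup>2)"
      using that by (intro member_le_sum) auto
    also have "\<dots> \<le> 1 / c" using E nonneg rj c by (smt (verit) mult_nonneg_nonneg)
    also have "1 / c = (1 / sqrt c)\<^sup>2" using c by (simp add: power_divide)
    finally show ?thesis using c by (simp add: power2_le_iff_abs_le)
  qed
qed

text \<open>When both sides of the hypothesis equal \<open>e\<close>, the vector \<open>r0\<close> minimises
  \<open>|e - X\<^sup>T X v|\<^sup>2 + c0 |X v|\<^sup>2\<close> over all \<open>v\<close>, and \<open>e - X\<^sup>T X r = c r\<close>.\<close>
lemma ridge_row_minimum:
  assumes X: "X \<in> carrier_mat n p" and r: "r \<in> carrier_vec p" and r0: "r0 \<in> carrier_vec p"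
    and c0: "0 < c0"
    and eq: "ridge_gram X c *\<^sub>v r = ridge_gram X c0 *\<^sub>v r0"
  shows "c0\<^sup>2 * scalar_prod r0 r0 + c0 * scalar_prod (X *\<^sub>v r0) (X *\<^sub>v r0)
           \<le> c\<^sup>2 * scalar_prod r r + c0 * scalar_prod (X *\<^sub>v r) (X *\<^sub>v r)"
proof -
  define u where "u = ridge_gram X 0 *\<^sub>v (r - r0)"
  have u: "u \<in> carrier_vec p" using ridge_gram_carrier[OF X, of 0] r r0 by (auto simp: u_def)
  have G: "ridge_gram X d *\<^sub>v v = X\<^sup>T *\<^sub>v (X *\<^sub>v v) + d \<cdot>\<^sub>v v"
    and Gc: "X\<^sup>T *\<^sub>v (X *\<^sub>v v) \<in> carrier_vec p" if "v \<in> carrier_vec p" for v d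
    using ridge_gram_mult_vec[OF X that] X that by auto
  have XrX: "X *\<^sub>v (r - r0) = X *\<^sub>v r - X *\<^sub>v r0"
    by (rule mult_minus_distrib_mat_vec[OF X r r0])
  have Xv: "X *\<^sub>v r \<in> carrier_vec n" "X *\<^sub>v r0 \<in> carrier_vec n" using X r r0 by auto
  have "X\<^sup>T *\<^sub>v (X *\<^sub>v r - X *\<^sub>v r0) = X\<^sup>T *\<^sub>v (X *\<^sub>v r) - X\<^sup>T *\<^sub>v (X *\<^sub>v r0)"
    using X Xv by (intro mult_minus_distrib_mat_vec[of _ p n]) auto
  moreover have "u = X\<^sup>T *\<^sub>v (X *\<^sub>v (r - r0))"
  proof -
    have "z + 0 \<cdot>\<^sub>v w = z" if "z \<in> carrier_vec p" "w \<in> carrier_vec p" for z w :: "real Matrix.vec"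
      using that by (intro eq_vecI) auto
    then show ?thesis
      unfolding u_def using Gc[of "r - r0"] r r0 by (subst G) auto
  qed
  ultimately have ueq: "u = X\<^sup>T *\<^sub>v (X *\<^sub>v r) - X\<^sup>T *\<^sub>v (X *\<^sub>v r0)" by (simp add: XrX)
  \<comment> \<open>Rearranging the hypothesis expresses \<open>c r\<close> through
    \<open>r0\<close> and \<open>u\<close>, so that the functional at \<open>r\<close> can be
    expanded around \<open>r0\<close>.\<close>
  have cr: "c \<cdot>\<^sub>v r = c0 \<cdot>\<^sub>v r0 - u"
  proof (rule eq_vecI)
    fix a assume "a < dim_vec (c0 \<cdot>\<^sub>v r0 - u)"
    then have a: "a < p" using u by simp
    have minus: "vec_index (c0 \<cdot>\<^sub>v r0 - (z - z0)) a = c0 * vec_index r0 a - (vec_index z a - vec_index z0 a)"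
      if "z \<in> carrier_vec p" "z0 \<in> carrier_vec p" for z z0
      using a r0 that by auto
    have "vec_index (X\<^sup>T *\<^sub>v (X *\<^sub>v r) + c \<cdot>\<^sub>v r) a = vec_index (X\<^sup>T *\<^sub>v (X *\<^sub>v r0) + c0 \<cdot>\<^sub>v r0) a"
      using eq by (simp only: G[OF r] G[OF r0])
    then show "vec_index (c \<cdot>\<^sub>v r) a = vec_index (c0 \<cdot>\<^sub>v r0 - u) a"
      unfolding ueq using a r r0 Gc[OF r] Gc[OF r0] minus[OF Gc[OF r] Gc[OF r0]]
      by (simp del: index_mult_mat_vec)
  qed (use u r in auto)
  have Xr: "X *\<^sub>v r = X *\<^sub>v r0 + X *\<^sub>v (r - r0)"
    unfolding XrX using Xv by (intro eq_vecI) (auto simp del: index_mult_mat_vec)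
  have cross: "scalar_prod r0 u = scalar_prod (X *\<^sub>v r0) (X *\<^sub>v (r - r0))"
    unfolding u_def using scalar_prod_ridge_gram[OF X _ r0, of "r - r0" 0] r r0
    by (simp del: index_mult_mat_vec)
  have "c\<^sup>2 * scalar_prod r r = scalar_prod (c \<cdot>\<^sub>v r) (c \<cdot>\<^sub>v r)"
    by (simp add: power2_eq_square)
  also have "\<dots> = c0\<^sup>2 * scalar_prod r0 r0 - 2 * c0 * scalar_prod r0 u + scalar_prod u u"
    unfolding cr using r0 u comm_scalar_prod[OF u r0]
    by (simp add: minus_scalar_prod_distrib[of _ p] scalar_prod_minus_distrib[of _ p] power2_eq_square algebra_simps)
  finally have e1: "c\<^sup>2 * scalar_prod r r = \<dots>" .
  have e2: "scalar_prod (X *\<^sub>v r) (X *\<^sub>v r) = scalar_prod (X *\<^sub>v r0) (X *\<^sub>v r0)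
      + 2 * scalar_prod r0 u + scalar_prod (X *\<^sub>v (r - r0)) (X *\<^sub>v (r - r0))"
    unfolding Xr cross using X r r0 comm_scalar_prod[of "X *\<^sub>v r0" n "X *\<^sub>v (r - r0)"]
    by (simp add: add_scalar_prod_distrib[of _ n] scalar_prod_add_distrib[of _ n])
  \<comment> \<open>The cross terms \<open>-2 * c0 * (r0 . u)\<close> of the first expansion and
    \<open>2 * c0 * (r0 . u)\<close> of the second cancel. What remains as excess is
    \<open>|u|^2 + c0 * |X (r - r0)|^2\<close>.\<close>
  have "0 \<le> scalar_prod u u" "0 \<le> scalar_prod (X *\<^sub>v (r - r0)) (X *\<^sub>v (r - r0))"
    unfolding scalar_prod_self_sum by (simp_all add: sum_nonneg)
  then show ?thesis unfolding e1 e2 using c0 by (simp add: algebra_simps)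
qed

text \<open>Both coordinates are pairings with \<open>r\<close>: that of \<open>b\<close> because
  the Gram matrix sends \<open>r\<close> to the unit vector, that of the estimator because
  \<open>r\<close> is a row of the inverse. The terms \<open>(X r) . (X b)\<close> cancel in the
  difference.\<close>

lemma ridge_error:
  assumes X: "X \<in> carrier_mat n p" and b: "b \<in> carrier_vec p" and e: "e \<in> carrier_vec n"
    and n: "0 < n" and l: "0 < l" and j: "j < p"
  defines "r \<equiv> Matrix.row (ridge_inverse X (real n * l)) j"
  shows "vec_index (b - ridge X (X *\<^sub>v b + e) l) j
           = real n * l * scalar_prod r b - scalar_prod (X *\<^sub>v r) e"
proof -
  define c where "c = real n * l"
  have c: "0 < c" using n l by (simp add: c_def)
  let ?R = "ridge_inverse X c"
  note R = ridge_inverse[OF X c]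
  have r: "r \<in> carrier_vec p" using R(1) j by (simp add: r_def c_def)
  have Xv: "X *\<^sub>v r \<in> carrier_vec n" "X *\<^sub>v b \<in> carrier_vec n" using X r b by auto
  have "vec_index b j = scalar_prod b (ridge_gram X c *\<^sub>v r)"
    using ridge_gram_mult_row[OF X c j] b j by (simp add: r_def c_def scalar_prod_right_unit)
  also have "\<dots> = scalar_prod (X *\<^sub>v r) (X *\<^sub>v b) + c * scalar_prod r b"
    unfolding scalar_prod_ridge_gram[OF X r b] comm_scalar_prod[OF b r] comm_scalar_prod[OF Xv] ..
  finally have b_eq: "vec_index b j = \<dots>" .
  have "vec_index (ridge X (X *\<^sub>v b + e) l) j = scalar_prod r (X\<^sup>T *\<^sub>v (X *\<^sub>v b + e))"
    using X R(1) j by (simp add: ridge_def r_def c_def ridge_inverse_def ridge_gram_def)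
  also have "\<dots> = scalar_prod (X *\<^sub>v r) (X *\<^sub>v b) + scalar_prod (X *\<^sub>v r) e"
    using Xv e by (simp add: scalar_prod_transpose_mult_vec[OF X r] scalar_prod_add_distrib[of _ n])
  finally show ?thesis
    using b_eq X R(1) j by (simp add: c_def ridge_def ridge_inverse_def ridge_gram_def)
qed

subsection \<open>Conditional expectations and independence\<close>

text \<open>A conditional expectation is determined only almost everywhere, and its calculation
  rules ask for integrability. Bundling the two lets the rules be chained.\<close>

definition has_cond_exp :: "'a measure \<Rightarrow> 'a measure \<Rightarrow> ('a \<Rightarrow> real) \<Rightarrow> ('a \<Rightarrow> real) \<Rightarrow> bool" where
  "has_cond_exp M F f g \<longleftrightarrow> integrable M f \<and> (AE x in M. real_cond_exp M F f x = g x)"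

lemma has_cond_exp_cong:
  "has_cond_exp M F f g \<Longrightarrow> (\<forall>x. f x = f' x) \<Longrightarrow> (\<forall>x. g x = g' x) \<Longrightarrow> has_cond_exp M F f' g'"
  unfolding fun_eq_iff[symmetric] by simp

context sigma_finite_subalgebra
begin

lemma has_cond_exp_add:
  assumes "has_cond_exp M F f g" "has_cond_exp M F f' g'"
  shows "has_cond_exp M F (\<lambda>x. f x + f' x) (\<lambda>x. g x + g' x)"
  using assms real_cond_exp_add[of f f'] unfolding has_cond_exp_def by fastforce

lemma has_cond_exp_sum:
  assumes "\<And>i. i \<in> I \<Longrightarrow> has_cond_exp M F (f i) (g i)"
  shows "has_cond_exp M F (\<lambda>x. \<Sum>i\<in>I. f i x) (\<lambda>x. \<Sum>i\<in>I. g i x)"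
proof -
  have zero: "has_cond_exp M F (\<lambda>x. 0) (\<lambda>x. 0)"
    using real_cond_exp_F_meas[of "\<lambda>x. 0"] by (simp add: has_cond_exp_def)
  show ?thesis
    using assms
    by (induction I rule: infinite_finite_induct) (simp_all add: zero has_cond_exp_add)
qed

text \<open>Boundedness of \<open>c\<close> supplies the integrability of the product that taking
  out a known factor requires.\<close>

lemma has_cond_exp_mult_bounded:
  assumes c[measurable]: "c \<in> borel_measurable F" and bound: "\<And>x. x \<in> space M \<Longrightarrow> \<bar>c x\<bar> \<le> B"
    and f: "has_cond_exp M F f g"
  shows "has_cond_exp M F (\<lambda>x. c x * f x) (\<lambda>x. c x * g x)"
proof -
  have [measurable]: "c \<in> borel_measurable M" by (rule measurable_from_subalg[OF subalg c])
  have int: "integrable M f" using f by (simp add: has_cond_exp_def)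
  have prod: "integrable M (\<lambda>x. c x * f x)"
  proof (rule Bochner_Integration.integrable_bound[of _ "\<lambda>x. B * f x"])
    show "AE x in M. norm (c x * f x) \<le> norm (B * f x)"
      using bound by (intro AE_I2) (force simp: abs_mult intro!: mult_right_mono)
  qed (use int in auto)
  with real_cond_exp_mult[OF c _ prod] int f show ?thesis
    unfolding has_cond_exp_def by fastforce
qed

text \<open>A conditional Pythagorean identity: after expanding the square, the
  \<open>F\<close>-measurable coefficients are taken out, and orthogonality leaves only the diagonal
  terms and the square of \<open>t\<close>.\<close>

lemma has_cond_exp_orthogonal_square:
  assumes "finite L"
    and c: "\<And>m. m \<in> L \<Longrightarrow> c m \<in> borel_measurable F"
      "\<And>m x. m \<in> L \<Longrightarrow> x \<in> space M \<Longrightarrow> \<bar>c m x\<bar> \<le> B"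
    and ww: "\<And>m m'. m \<in> L \<Longrightarrow> m' \<in> L \<Longrightarrow>
      has_cond_exp M F (\<lambda>x. w m x * w m' x) (\<lambda>x. if m = m' then d m else 0)"
    and tw: "\<And>m. m \<in> L \<Longrightarrow> has_cond_exp M F (\<lambda>x. t x * w m x) (\<lambda>x. 0)"
    and tt: "has_cond_exp M F (\<lambda>x. (t x)\<^sup>2) (\<lambda>x. s)"
  shows "has_cond_exp M F (\<lambda>x. ((\<Sum>m\<in>L. c m x * w m x) + t x)\<^sup>2)
           (\<lambda>x. (\<Sum>m\<in>L. d m * (c m x)\<^sup>2) + s)"
proof -
  have cc: "(\<lambda>x. c m x * c m' x) \<in> borel_measurable F" "(\<lambda>x. 2 * c m x) \<in> borel_measurable F"
    if "m \<in> L" "m' \<in> L" for m m'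
    using c(1)[OF that(1)] c(1)[OF that(2)] by measurable
  have B: "\<bar>c m x * c m' x\<bar> \<le> B * B" "\<bar>2 * c m x\<bar> \<le> 2 * B"
    if "m \<in> L" "m' \<in> L" "x \<in> space M" for m m' x
    using c(2)[OF that(1,3)] c(2)[OF that(2,3)] by (auto simp: abs_mult intro!: mult_mono)
  have lhs: "(\<lambda>x. ((\<Sum>m\<in>L. c m x * w m x) + t x)\<^sup>2) =
    (\<lambda>x. (\<Sum>m\<in>L. \<Sum>m'\<in>L. (c m x * c m' x) * (w m x * w m' x))
       + (\<Sum>m\<in>L. (2 * c m x) * (t x * w m x)) + (t x)\<^sup>2)"
  proof
    fix x
    let ?S = "\<Sum>m\<in>L. c m x * w m x"
    have "(?S + t x)\<^sup>2 = ?S * ?S + 2 * t x * ?S + (t x)\<^sup>2"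
      by (simp add: power2_eq_square distrib_left distrib_right)
    also have "?S * ?S = (\<Sum>m\<in>L. \<Sum>m'\<in>L. (c m x * c m' x) * (w m x * w m' x))"
      by (simp add: sum_product mult_ac)
    also have "2 * t x * ?S = (\<Sum>m\<in>L. (2 * c m x) * (t x * w m x))"
      by (simp add: sum_distrib_left mult_ac)
    finally show "(?S + t x)\<^sup>2 = (\<Sum>m\<in>L. \<Sum>m'\<in>L. (c m x * c m' x) * (w m x * w m' x))
       + (\<Sum>m\<in>L. (2 * c m x) * (t x * w m x)) + (t x)\<^sup>2" .
  qed
  \<comment> \<open>The result is inflated to the shape of the expanded square, zeros included, so
    that the rules for sums and products match it term by term.\<close>
  have rhs: "(\<lambda>x. (\<Sum>m\<in>L. d m * (c m x)\<^sup>2) + s) =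
    (\<lambda>x. (\<Sum>m\<in>L. \<Sum>m'\<in>L. (c m x * c m' x) * (if m = m' then d m else 0))
       + (\<Sum>m\<in>L. (2 * c m x) * 0) + s)"
    using \<open>finite L\<close> by (simp add: if_distrib[of "\<lambda>y. _ * y"] power2_eq_square mult_ac cong: if_cong)
  show ?thesis
    unfolding lhs rhs
    by (intro has_cond_exp_add has_cond_exp_sum has_cond_exp_mult_bounded[OF cc(1) B(1)]
        has_cond_exp_mult_bounded[OF cc(2) B(2)] ww tw tt)
qed

end

section \<open>Conditional expectations of products of independent factors\<close>

context prob_space
begin

lemma subalgebra_sigma_finite: "subalgebra M F \<Longrightarrow> sigma_finite_subalgebra M F"
  by (rule finite_measure_subalgebra_is_sigma_finite) unfold_locales

lemma indep_vars_of_indep_sets: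
  assumes indep: "indep_sets (\<lambda>k. sets (F k)) I"
    and space: "\<And>k. k \<in> I \<Longrightarrow> space (F k) = space M"
    and V: "\<And>k. k \<in> I \<Longrightarrow> V k \<in> borel_measurable (F k)"
  shows "indep_vars (\<lambda>_. borel) V I"
  unfolding indep_vars_def2
proof (intro conjI ballI)
  show "random_variable borel (V k)" if "k \<in> I" for k
    using indep space[OF that] V[OF that] that unfolding indep_sets_def measurable_def by auto
  show "indep_sets (\<lambda>k. {V k -` A \<inter> space M |A. A \<in> sets borel}) I"
    by (rule indep_sets_mono_sets[OF indep]) (use V space in \<open>force dest: measurable_sets\<close>)
qed

text \<open>It suffices to compare integrals over each \<open>A\<close> in \<open>F k\<close>. The
  indicator of \<open>A\<close> fills the vacant slot \<open>k\<close> of the independent family,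
  and the expectation of the full product factorises.\<close>

lemma has_cond_exp_indep:
  assumes I: "finite I" "k \<in> I"
    and indep: "indep_sets (\<lambda>k. sets (F k)) I"
    and space: "\<And>i. i \<in> I \<Longrightarrow> space (F i) = space M"
    and W: "\<And>i. i \<in> I - {k} \<Longrightarrow> W i \<in> borel_measurable (F i)"
      "\<And>i. i \<in> I - {k} \<Longrightarrow> integrable M (W i)"
  shows "has_cond_exp M (F k) (\<lambda>x. \<Prod>i\<in>I-{k}. W i x) (\<lambda>x. \<Prod>i\<in>I-{k}. expectation (W i))"
proof -
  let ?c = "\<Prod>i\<in>I-{k}. expectation (W i)"
  have sub: "subalgebra M (F k)"
    using indep I space by (auto simp: subalgebra_def indep_sets_def)
  interpret sigma_finite_subalgebra M "F k" by (rule subalgebra_sigma_finite[OF sub])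
  have restr: "indep_vars (\<lambda>_. borel) W (I - {k})"
    by (rule indep_vars_of_indep_sets[of F]) (use indep_sets_mono_index[OF _ indep, of "I - {k}"] space W in auto)
  have int: "integrable M (\<lambda>x. \<Prod>i\<in>I-{k}. W i x)"
    using I W(2) restr by (intro indep_vars_integrable) auto
  have "(\<integral>x\<in>A. (\<Prod>i\<in>I-{k}. W i x) \<partial>M) = (\<integral>x\<in>A. ?c \<partial>M)" if A: "A \<in> sets (F k)" for A
  proof -
    have AM: "A \<in> events" using A sub by (auto simp: subalgebra_def)
    define V where "V = W(k := indicator A)"
    have V: "indep_vars (\<lambda>_. borel) V I"
      by (rule indep_vars_of_indep_sets[OF indep space]) (use W A in \<open>auto simp: V_def\<close>)
    have Vi: "integrable M (V i)" if "i \<in> I" for i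
      using that W(2) AM by (auto simp: V_def less_top[symmetric])
    have split: "(\<Prod>i\<in>I. f i) = f k * (\<Prod>i\<in>I-{k}. f i)" for f :: "_ \<Rightarrow> real"
      using I by (rule prod.remove)
    have "(\<integral>x\<in>A. (\<Prod>i\<in>I-{k}. W i x) \<partial>M) = expectation (\<lambda>x. \<Prod>i\<in>I. V i x)"
      unfolding set_lebesgue_integral_def split
      by (intro Bochner_Integration.integral_cong) (auto simp: V_def intro!: prod.cong)
    also have "\<dots> = (\<Prod>i\<in>I. expectation (V i))"
      by (rule indep_vars_lebesgue_integral[OF I(1) V Vi])
    also have "\<dots> = prob A * ?c"
      unfolding split using AM by (auto simp: V_def intro!: prod.cong)
    also have "\<dots> = (\<integral>x\<in>A. ?c \<partial>M)"
      using AM by (simp add: set_integral_const)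
    finally show ?thesis .
  qed
  then have "AE x in M. real_cond_exp M (F k) (\<lambda>x. \<Prod>i\<in>I-{k}. W i x) x = ?c"
    by (rule real_cond_exp_charact) (use int in auto)
  with int show ?thesis by (simp add: has_cond_exp_def)
qed

lemma iid_centered_second_moments:
  assumes iid: "iid_centered M I V v" and i: "i \<in> I" and k: "k \<in> I"
  shows "integrable M (\<lambda>x. V i x * V k x)"
    and "expectation (\<lambda>x. V i x * V k x) = (if i = k then v else 0)"
proof -
  note V = iid[unfolded iid_centered_def]
  have "integrable M (\<lambda>x. V i x * V k x) \<and> expectation (\<lambda>x. V i x * V k x) = (if i = k then v else 0)"
  proof (cases "i = k")
    case True
    with V k show ?thesis by (simp add: power2_eq_square)
  next
    case False
    have ind: "indep_vars (\<lambda>_. borel) V {i, k}"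
      using V i k by (auto intro: indep_vars_subset)
    have "integrable M (V j)" "expectation (V j) = 0" if "j \<in> {i, k}" for j
      using V i k that by auto
    with indep_vars_integrable[OF _ ind] indep_vars_lebesgue_integral[OF _ ind] False
    show ?thesis by simp
  qed
  then show "integrable M (\<lambda>x. V i x * V k x)"
    "expectation (\<lambda>x. V i x * V k x) = (if i = k then v else 0)" by auto
qed

end

section \<open>Generated sigma-algebras and measurability of determinants and inverses\<close>

lemma gen_algebra_component:
  assumes "i \<in> I"
  shows "V i \<in> borel_measurable (gen_algebra M I V)"
proof -
  have "(\<lambda>\<omega>. \<lambda>i\<in>I. V i \<omega>) \<in> measurable (gen_algebra M I V) (\<Pi>\<^sub>M i\<in>I. borel)"
    unfolding gen_algebra_def by (rule measurable_vimage_algebra1) (auto simp: space_PiM)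
  from measurable_compose[OF this measurable_component_singleton[OF assms]] assms
  show ?thesis by simp
qed

lemma space_gen_algebra: "space (gen_algebra M I V) = space M"
  by (simp add: gen_algebra_def)

text \<open>The Leibniz formula makes the determinant a polynomial in the entries.\<close>

lemma borel_measurable_det:
  fixes A :: "'a \<Rightarrow> real Matrix.mat"
  assumes A: "\<And>x. A x \<in> carrier_mat k k"
    and entries: "\<And>i j. i < k \<Longrightarrow> j < k \<Longrightarrow> (\<lambda>x. A x $$ (i, j)) \<in> borel_measurable N"
  shows "(\<lambda>x. Determinant.det (A x)) \<in> borel_measurable N"
  unfolding det_def'[OF A]
  by (intro borel_measurable_sum borel_measurable_times borel_measurable_prod borel_measurable_const entries)
    (auto dest: permutes_in_image)

lemma borel_measurable_adj_mat:
  fixes A :: "'a \<Rightarrow> real Matrix.mat"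
  assumes A: "\<And>x. A x \<in> carrier_mat k k"
    and entries: "\<And>i j. i < k \<Longrightarrow> j < k \<Longrightarrow> (\<lambda>x. A x $$ (i, j)) \<in> borel_measurable N"
    and ij: "i < k" "j < k"
  shows "(\<lambda>x. adj_mat (A x) $$ (i, j)) \<in> borel_measurable N"
proof -
  have dims: "dim_row (A x) = k" "dim_col (A x) = k" for x
    using A[of x] by auto
  have "(\<lambda>x. Determinant.det (mat_delete (A x) j i)) \<in> borel_measurable N"
  proof (rule borel_measurable_det)
    show "mat_delete (A x) j i \<in> carrier_mat (k - 1) (k - 1)" for x
      using A by (rule mat_delete_carrier)
    show "(\<lambda>x. mat_delete (A x) j i $$ (i', j')) \<in> borel_measurable N"
      if "i' < k - 1" "j' < k - 1" for i' j'
      using that by (simp add: mat_delete_def dims entries)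
  qed
  then show ?thesis
    using ij by (simp add: adj_mat_def dims cofactor_def)
qed

subsection \<open>The empirical risk\<close>

text \<open>By the adjugate formula each entry of the inverse is a quotient of two polynomials in
  the entries of the design.\<close>

lemma borel_measurable_ridge_inverse:
  fixes X :: "'a \<Rightarrow> real Matrix.mat"
  assumes X: "\<And>x. X x \<in> carrier_mat n p" and c: "0 < c"
    and entries: "\<And>i j. i < n \<Longrightarrow> j < p \<Longrightarrow> (\<lambda>x. X x $$ (i, j)) \<in> borel_measurable N"
    and ja: "j < p" "a < p"
  shows "(\<lambda>x. ridge_inverse (X x) c $$ (j, a)) \<in> borel_measurable N"
proof -
  have dims: "dim_row (X x) = n" "dim_col (X x) = p" for x using X[of x] by auto
  note A = ridge_gram_carrier[OF X]
  have "ridge_gram (X x) c $$ (i, j) = (\<Sum>k<n. X x $$ (k, i) * X x $$ (k, j)) + (if i = j then c else 0)"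
    if "i < p" "j < p" for i j x
    using that by (simp add: ridge_gram_def dims scalar_prod_def atLeast0LessThan)
  then have gram: "(\<lambda>x. ridge_gram (X x) c $$ (i, j)) \<in> borel_measurable N" if "i < p" "j < p" for i j
    using that
    by (simp only: simp_thms) (intro borel_measurable_add borel_measurable_sum borel_measurable_times
        borel_measurable_const entries; simp)
  have "(\<lambda>x. 1 / Determinant.det (ridge_gram (X x) c) * adj_mat (ridge_gram (X x) c) $$ (j, a))
          \<in> borel_measurable N"
    by (intro borel_measurable_times borel_measurable_divide borel_measurable_const
        borel_measurable_det[OF A gram] borel_measurable_adj_mat[OF A gram] ja)
  moreover have "ridge_inverse (X x) c $$ (j, a)
      = 1 / Determinant.det (ridge_gram (X x) c) * adj_mat (ridge_gram (X x) c) $$ (j, a)" for x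
    using adj_mat(1)[OF A[of x c]] ja by (simp add: ridge_inverse_adj[OF X c])
  ultimately show ?thesis by simp
qed

section \<open>Prediction error as a linear combination of products of test and noise
  coordinates\<close>

context ridge_model
begin

text \<open>The sum type merges signal (\<open>Inl\<close>) and observation noise
  (\<open>Inr\<close>) into one family, so a single orthogonality argument covers both.\<close>

definition noise :: "nat + nat \<Rightarrow> 'a \<Rightarrow> real" where
  "noise = case_sum \<beta> eps"

definition test_coord :: "nat \<Rightarrow> 'a \<Rightarrow> real" where
  "test_coord j \<omega> = vec_index (test_point p \<gamma>t zt \<omega>) j"

definition ridge_row :: "real \<Rightarrow> nat \<Rightarrow> 'a \<Rightarrow> real Matrix.vec" where
  "ridge_row l j \<omega> = Matrix.row (ridge_inverse (design_mat n p \<gamma> Z \<omega>) (real n * l)) j"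

text \<open>The part of the prediction error determined by the design: the factor of
  \<open>test_coord j * noise k\<close>, as read off from \<open>ridge_error\<close>.\<close>

definition error_coeff :: "real \<Rightarrow> nat \<times> (nat + nat) \<Rightarrow> 'a \<Rightarrow> real" where
  "error_coeff l m \<omega> = (case m of (j, k) \<Rightarrow> (case k of
       Inl a \<Rightarrow> real n * l * vec_index (ridge_row l j \<omega>) a
     | Inr i \<Rightarrow> - vec_index (design_mat n p \<gamma> Z \<omega> *\<^sub>v ridge_row l j \<omega>) i))"

abbreviation index_set :: "(nat \<times> (nat + nat)) set" where
  "index_set \<equiv> {..<p} \<times> ({..<p} <+> {..<n})"

lemma design_carrier: "design_mat n p \<gamma> Z \<omega> \<in> carrier_mat n p"
  by (simp add: design_mat_def)

lemma ridge_row_carrier: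
  assumes "0 < n" "0 < l" "j < p"
  shows "ridge_row l j \<omega> \<in> carrier_vec p"
  using ridge_inverse_carrier[OF design_carrier, of "real n * l"] assms by (simp add: ridge_row_def)

lemma ridge_row_eq:
  assumes "0 < n" "0 < l" "j < p"
  shows "ridge_gram (design_mat n p \<gamma> Z \<omega>) (real n * l) *\<^sub>v ridge_row l j \<omega> = unit_vec p j"
  unfolding ridge_row_def using assms by (intro ridge_gram_mult_row[OF design_carrier]) auto

lemma test_coord_eq: "j < p \<Longrightarrow> test_coord j \<omega> = \<bar>\<gamma>t j\<bar> * zt j \<omega>"
  by (simp add: test_coord_def test_point_def mat_diag_def scalar_prod_def if_distrib[of "\<lambda>x. x * _"]
      cong: if_cong)

text \<open>The formula for each coordinate of the estimation error is inserted into its scalar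
  product with the test point. This separates the design from the remaining randomness.\<close>

lemma test_error_eq:
  assumes pos: "0 < n" "0 < l"
  shows "test_response p \<gamma>t zt \<beta> epst \<omega>
           - scalar_prod (test_point p \<gamma>t zt \<omega>) (ridge (design_mat n p \<gamma> Z \<omega>) (response n p \<gamma> Z \<beta> eps \<omega>) l)
         = (\<Sum>m\<in>index_set. error_coeff l m \<omega> * (case m of (j, k) \<Rightarrow> test_coord j \<omega> * noise k \<omega>)) + epst \<omega>"
proof -
  let ?X = "design_mat n p \<gamma> Z \<omega>"
  let ?b = "Matrix.vec p (\<lambda>j. \<beta> j \<omega>)" and ?e = "Matrix.vec n (\<lambda>i. eps i \<omega>)"
  let ?x = "test_point p \<gamma>t zt \<omega>"
  define \<theta> where "\<theta> = ridge ?X (?X *\<^sub>v ?b + ?e) l"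
  have \<theta>: "\<theta> \<in> carrier_vec p"
    using ridge_inverse_carrier[OF design_carrier[of \<omega>], of "real n * l"] pos design_carrier[of \<omega>]
    by (auto simp: \<theta>_def ridge_def ridge_inverse_def ridge_gram_def)
  have x: "?x \<in> carrier_vec p"
    unfolding test_point_def by (rule mult_mat_vec_carrier[of _ p p]) auto
  have dim: "dim_vec (?b - \<theta>) = p" using \<theta> by auto
  have err: "vec_index (?b - \<theta>) j = (\<Sum>k\<in>{..<p} <+> {..<n}. error_coeff l (j, k) \<omega> * noise k \<omega>)"
    if j: "j < p" for j
  proof -
    have "vec_index (?b - \<theta>) j = real n * l * scalar_prod (ridge_row l j \<omega>) ?b
            - scalar_prod (?X *\<^sub>v ridge_row l j \<omega>) ?e"
      unfolding \<theta>_def ridge_row_def by (rule ridge_error[OF design_carrier _ _ pos j]) auto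
    also have "\<dots> = (\<Sum>k\<in>{..<p} <+> {..<n}. error_coeff l (j, k) \<omega> * noise k \<omega>)"
      by (simp add: sum.Plus scalar_prod_def error_coeff_def noise_def sum_distrib_left
          sum_negf atLeast0LessThan mult.assoc del: index_mult_mat_vec)
    finally show ?thesis .
  qed
  have "test_response p \<gamma>t zt \<beta> epst \<omega> - scalar_prod ?x (ridge ?X (response n p \<gamma> Z \<beta> eps \<omega>) l)
          = scalar_prod ?x (?b - \<theta>) + epst \<omega>"
    unfolding test_response_def response_def \<theta>_def[symmetric]
    by (subst scalar_prod_minus_distrib[OF x _ \<theta>]) auto
  also have "scalar_prod ?x (?b - \<theta>) = (\<Sum>j<p. test_coord j \<omega> * vec_index (?b - \<theta>) j)"
    using dim by (simp add: scalar_prod_def test_coord_def atLeast0LessThan del: index_minus_vec)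
  also have "\<dots> = (\<Sum>j<p. \<Sum>k\<in>{..<p} <+> {..<n}. error_coeff l (j, k) \<omega> * (test_coord j \<omega> * noise k \<omega>))"
  proof (intro sum.cong refl)
    fix j assume "j \<in> {..<p}"
    then have "vec_index (?b - \<theta>) j = (\<Sum>k\<in>{..<p} <+> {..<n}. error_coeff l (j, k) \<omega> * noise k \<omega>)"
      by (intro err) simp
    then show "test_coord j \<omega> * vec_index (?b - \<theta>) j
        = (\<Sum>k\<in>{..<p} <+> {..<n}. error_coeff l (j, k) \<omega> * (test_coord j \<omega> * noise k \<omega>))"
      by (simp only: sum_distrib_left mult.left_commute)
  qed
  also have "\<dots> = (\<Sum>m\<in>index_set. error_coeff l m \<omega> * (case m of (j, k) \<Rightarrow> test_coord j \<omega> * noise k \<omega>))"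
    by (simp add: sum.cartesian_product case_prod_unfold)
  finally show ?thesis .
qed

section \<open>Conditional moments given the design\<close>

definition indep_algebra :: "nat \<Rightarrow> 'a measure" where
  "indep_algebra k =
     [gen_algebra M {..<p} \<beta>,
      design_algebra M n p \<gamma> Z,
      gen_algebra M {..<n} eps,
      gen_algebra M {..<p} (\<lambda>j \<omega>. vec_index (test_point p \<gamma>t zt \<omega>) j),
      vimage_algebra (space M) epst borel] ! k"

lemma indep_algebra_simps:
  "indep_algebra 0 = gen_algebra M {..<p} \<beta>"
  "indep_algebra 1 = design_algebra M n p \<gamma> Z"
  "indep_algebra 2 = gen_algebra M {..<n} eps"
  "indep_algebra 3 = gen_algebra M {..<p} test_coord"
  "indep_algebra 4 = vimage_algebra (space M) epst borel"
  by (simp_all add: indep_algebra_def test_coord_def[abs_def])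

lemma space_indep_algebra:
  assumes "k < 5"
  shows "space (indep_algebra k) = space M"
proof -
  have "k = 0 \<or> k = 1 \<or> k = 2 \<or> k = 3 \<or> k = 4" using assms by linarith
  then show ?thesis
    by (elim disjE) (simp_all only: indep_algebra_simps design_algebra_def space_gen_algebra space_vimage_algebra)
qed

lemma indep_algebra_indep: "indep_sets (\<lambda>k. sets (indep_algebra k)) {..<5}"
  using mutually_indep unfolding indep_algebra_def .

text \<open>Independence of families of sets already contains that their members are events.\<close>

lemma design_subalgebra: "subalgebra M (design_algebra M n p \<gamma> Z)"
  using indep_algebra_indep space_indep_algebra[of 1]
  by (auto simp: indep_sets_def subalgebra_def indep_algebra_simps(2)[symmetric] simp del: One_nat_def)

sublocale design: sigma_finite_subalgebra M "design_algebra M n p \<gamma> Z"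
  by (rule subalgebra_sigma_finite[OF design_subalgebra])

lemma indep_algebra_measurable:
  "a < p \<Longrightarrow> \<beta> a \<in> borel_measurable (indep_algebra 0)"
  "i < n \<Longrightarrow> eps i \<in> borel_measurable (indep_algebra 2)"
  "j < p \<Longrightarrow> test_coord j \<in> borel_measurable (indep_algebra 3)"
  "epst \<in> borel_measurable (indep_algebra 4)"
  unfolding indep_algebra_simps
  by (auto intro: gen_algebra_component measurable_vimage_algebra1)

lemma design_entry_measurable:
  assumes "i < n" "j < p"
  shows "(\<lambda>\<omega>. design_mat n p \<gamma> Z \<omega> $$ (i, j)) \<in> borel_measurable (design_algebra M n p \<gamma> Z)"
  unfolding design_algebra_def
  using gen_algebra_component[of "(i, j)" "{..<n} \<times> {..<p}" "\<lambda>ij \<omega>. design_mat n p \<gamma> Z \<omega> $$ ij"] assms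
  by simp

text \<open>Index 1 is the conditioning sigma-algebra of the design; \<open>f0\<close>,
  \<open>f2\<close>, \<open>f3\<close>, \<open>f4\<close> occupy the slots of signal, noise, test
  point and test noise.\<close>

lemma has_cond_exp_product:
  assumes "f0 \<in> borel_measurable (indep_algebra 0)" "integrable M f0"
    and "f2 \<in> borel_measurable (indep_algebra 2)" "integrable M f2"
    and "f3 \<in> borel_measurable (indep_algebra 3)" "integrable M f3"
    and "f4 \<in> borel_measurable (indep_algebra 4)" "integrable M f4"
  shows "has_cond_exp M (design_algebra M n p \<gamma> Z) (\<lambda>\<omega>. f0 \<omega> * f2 \<omega> * f3 \<omega> * f4 \<omega>)
           (\<lambda>_. expectation f0 * expectation f2 * expectation f3 * expectation f4)"
proof -
  have I: "{..<5} - {1} = {0, 2, 3, 4::nat}" by auto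
  define W where "W k = (if k = 0 then f0 else if k = 2 then f2 else if k = 3 then f3 else f4)" for k :: nat
  have "has_cond_exp M (indep_algebra 1) (\<lambda>x. \<Prod>i\<in>{..<5}-{1}. W i x) (\<lambda>x. \<Prod>i\<in>{..<5}-{1}. expectation (W i))"
  proof (rule has_cond_exp_indep[OF _ _ indep_algebra_indep space_indep_algebra])
    fix i :: nat assume "i \<in> {..<5} - {1}"
    then have "i = 0 \<or> i = 2 \<or> i = 3 \<or> i = 4" unfolding I by blast
    then show "W i \<in> borel_measurable (indep_algebra i)" "integrable M (W i)"
      using assms by (auto simp: W_def)
  qed simp_all
  then show ?thesis
    unfolding I indep_algebra_simps(2) by (simp add: W_def mult.assoc)
qed

lemma test_coord_moments:
  assumes "j < p" "j' < p"
  shows "integrable M (test_coord j)"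
    and "integrable M (\<lambda>\<omega>. test_coord j \<omega> * test_coord j' \<omega>)"
    and "expectation (\<lambda>\<omega>. test_coord j \<omega> * test_coord j' \<omega>) = (if j = j' then (\<gamma>t j)\<^sup>2 else 0)"
proof -
  have eq: "test_coord j = (\<lambda>\<omega>. \<bar>\<gamma>t j\<bar> * zt j \<omega>)"
    and eq2: "(\<lambda>\<omega>. test_coord j \<omega> * test_coord j' \<omega>) = (\<lambda>\<omega>. (\<bar>\<gamma>t j\<bar> * \<bar>\<gamma>t j'\<bar>) * (zt j \<omega> * zt j' \<omega>))"
    using assms by (auto simp: test_coord_eq mult_ac)
  have "integrable M (zt j)" using zt assms by (auto simp: iid_centered_def)
  moreover note iid_centered_second_moments[OF zt, of j j']
  ultimately show "integrable M (test_coord j)"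
    "integrable M (\<lambda>\<omega>. test_coord j \<omega> * test_coord j' \<omega>)"
    "expectation (\<lambda>\<omega>. test_coord j \<omega> * test_coord j' \<omega>) = (if j = j' then (\<gamma>t j)\<^sup>2 else 0)"
    unfolding eq2 unfolding eq using assms by (auto simp: power2_eq_square simp flip: abs_mult)
qed

lemma error_coeff_measurable:
  assumes pos: "0 < n" "0 < l" and m: "m \<in> index_set"
  shows "error_coeff l m \<in> borel_measurable (design_algebra M n p \<gamma> Z)"
proof -
  have c: "0 < real n * l" using pos by simp
  have row: "(\<lambda>\<omega>. vec_index (ridge_row l j \<omega>) a) \<in> borel_measurable (design_algebra M n p \<gamma> Z)"
    if "j < p" "a < p" for j a
  proof -
    have "vec_index (ridge_row l j \<omega>) a = ridge_inverse (design_mat n p \<gamma> Z \<omega>) (real n * l) $$ (j, a)" for \<omega>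
      using that ridge_inverse_carrier[OF design_carrier c, of \<omega>] by (simp add: ridge_row_def)
    then show ?thesis
      using borel_measurable_ridge_inverse[OF design_carrier c design_entry_measurable that] by simp
  qed
  have "(\<lambda>\<omega>. vec_index (design_mat n p \<gamma> Z \<omega> *\<^sub>v ridge_row l j \<omega>) i) \<in> borel_measurable (design_algebra M n p \<gamma> Z)"
    if "j < p" "i < n" for j i
  proof -
    have "vec_index (design_mat n p \<gamma> Z \<omega> *\<^sub>v ridge_row l j \<omega>) i
        = (\<Sum>a<p. design_mat n p \<gamma> Z \<omega> $$ (i, a) * vec_index (ridge_row l j \<omega>) a)" for \<omega>
      using design_carrier[of \<omega>] ridge_row_carrier[OF pos that(1), of \<omega>] that
      by (simp add: scalar_prod_def atLeast0LessThan)
    then show ?thesis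
      using that
      by (simp only:) (intro borel_measurable_sum borel_measurable_times row design_entry_measurable; simp)
  qed
  with m row show ?thesis
    by (auto simp: error_coeff_def[abs_def] simp del: index_mult_mat_vec)
qed

text \<open>With \<open>c = n * l\<close>, the signal coefficients are at most
  \<open>c * (1 / c) = 1\<close> and the noise coefficients at most \<open>1 / sqrt c\<close>. The
  sum serves as one constant for both.\<close>

lemma error_coeff_bound:
  assumes pos: "0 < n" "0 < l" and m: "m \<in> index_set"
  shows "\<bar>error_coeff l m \<omega>\<bar> \<le> 1 + 1 / sqrt (real n * l)"
proof -
  have c: "0 < real n * l" using pos by simp
  have s: "0 \<le> 1 / sqrt (real n * l)" using c by simp
  note B = ridge_row_bounds[OF design_carrier _ ridge_row_carrier[OF pos] c ridge_row_eq[OF pos]]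
  obtain j k where jk: "m = (j, k)" by force
  show ?thesis
  proof (cases k)
    case (Inl a)
    with m jk have "\<bar>vec_index (ridge_row l j \<omega>) a\<bar> \<le> 1 / (real n * l)"
      by (intro B(1)) auto
    then have "\<bar>real n * l * vec_index (ridge_row l j \<omega>) a\<bar> \<le> 1"
      using c pos by (simp add: abs_mult field_simps)
    with s show ?thesis unfolding error_coeff_def jk Inl prod.case sum.case by linarith
  next
    case (Inr i)
    with m jk have "\<bar>vec_index (design_mat n p \<gamma> Z \<omega> *\<^sub>v ridge_row l j \<omega>) i\<bar> \<le> 1 / sqrt (real n * l)"
      by (intro B(2)) auto
    then show ?thesis by (simp add: error_coeff_def jk Inr del: index_mult_mat_vec)
  qed
qed

text \<open>A version of the conditional risk defined at every outcome. Here \<open>\<tau>\<close>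
  is the variance of one signal coordinate, later \<open>\<alpha>\<^sup>2 / p\<close>.\<close>

definition risk_formula :: "real \<Rightarrow> real \<Rightarrow> 'a \<Rightarrow> real" where
  "risk_formula \<tau> l \<omega> =
     (\<Sum>(j, k)\<in>index_set. (\<gamma>t j)\<^sup>2 * case_sum (\<lambda>_. \<tau>) (\<lambda>_. \<sigma>\<^sup>2) k * (error_coeff l (j, k) \<omega>)\<^sup>2) + \<sigma>\<^sup>2"

section \<open>Conditional risk for a centred signal with uncorrelated coordinates\<close>

context
  fixes \<tau> :: real
  assumes beta_mean: "\<And>j. j < p \<Longrightarrow> integrable M (\<beta> j) \<and> expectation (\<beta> j) = 0"
    and beta_cov: "\<And>j k. j < p \<Longrightarrow> k < p \<Longrightarrow> integrable M (\<lambda>\<omega>. \<beta> j \<omega> * \<beta> k \<omega>) \<and>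
          expectation (\<lambda>\<omega>. \<beta> j \<omega> * \<beta> k \<omega>) = (if j = k then \<tau> else 0)"
begin

text \<open>Products of two signal or two noise coordinates give their covariances. Mixed products
  vanish because signal and noise are independent and the signal is centred; products with
  \<open>epst\<close> vanish by centring of \<open>noise k\<close>.\<close>

lemma has_cond_exp_noise_products:
  assumes m: "(j, k) \<in> index_set" and m': "(j', k') \<in> index_set"
  shows "has_cond_exp M (design_algebra M n p \<gamma> Z)
      (\<lambda>\<omega>. (test_coord j \<omega> * noise k \<omega>) * (test_coord j' \<omega> * noise k' \<omega>))
      (\<lambda>_. if (j, k) = (j', k') then (\<gamma>t j)\<^sup>2 * case_sum (\<lambda>_. \<tau>) (\<lambda>_. \<sigma>\<^sup>2) k else 0)"
    and "has_cond_exp M (design_algebra M n p \<gamma> Z)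
      (\<lambda>\<omega>. epst \<omega> * (test_coord j \<omega> * noise k \<omega>)) (\<lambda>_. 0)"
proof -
  have j: "j < p" "j' < p" using m m' by auto
  have eps1: "integrable M (eps i)" "expectation (eps i) = 0" if "i < n" for i
    using eps that by (auto simp: iid_centered_def)
  note eps2 = iid_centered_second_moments[OF eps]
  note meas = indep_algebra_measurable
  note xx = test_coord_moments[OF j]
  \<comment> \<open>The constant 1 fills those slots of the product rule that carry no
    factor.\<close>
  have one: "(\<lambda>_. 1 :: real) \<in> borel_measurable (indep_algebra k)" "integrable M (\<lambda>_. 1 :: real)" for k
    by auto
  have xxm: "(\<lambda>\<omega>. test_coord j \<omega> * test_coord j' \<omega>) \<in> borel_measurable (indep_algebra 3)"
    by (intro borel_measurable_times meas j)
  show "has_cond_exp M (design_algebra M n p \<gamma> Z)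
      (\<lambda>\<omega>. (test_coord j \<omega> * noise k \<omega>) * (test_coord j' \<omega> * noise k' \<omega>))
      (\<lambda>_. if (j, k) = (j', k') then (\<gamma>t j)\<^sup>2 * case_sum (\<lambda>_. \<tau>) (\<lambda>_. \<sigma>\<^sup>2) k else 0)"
  proof (cases k; cases k')
    fix a b assume k: "k = Inl a" "k' = Inl b"
    then have ab: "a < p" "b < p" using m m' by auto
    have "(\<lambda>\<omega>. \<beta> a \<omega> * \<beta> b \<omega>) \<in> borel_measurable (indep_algebra 0)"
      by (intro borel_measurable_times meas ab)
    from has_cond_exp_product[OF this conjunct1[OF beta_cov[OF ab]] one xxm xx(2) one] beta_cov[OF ab] show ?thesis
      by (elim has_cond_exp_cong) (auto simp: noise_def k xx(3) prob_space)
  next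
    fix a i assume k: "k = Inl a" "k' = Inr i"
    then have ai: "a < p" "i < n" using m m' by auto
    from has_cond_exp_product[OF meas(1)[OF ai(1)] conjunct1[OF beta_mean[OF ai(1)]] meas(2)[OF ai(2)] eps1(1)[OF ai(2)] xxm xx(2) one]
      beta_mean[OF ai(1)] show ?thesis
      by (elim has_cond_exp_cong) (auto simp: noise_def k)
  next
    fix a i assume k: "k = Inr i" "k' = Inl a"
    then have ai: "a < p" "i < n" using m m' by auto
    from has_cond_exp_product[OF meas(1)[OF ai(1)] conjunct1[OF beta_mean[OF ai(1)]] meas(2)[OF ai(2)] eps1(1)[OF ai(2)] xxm xx(2) one]
      beta_mean[OF ai(1)] show ?thesis
      by (elim has_cond_exp_cong) (auto simp: noise_def k)
  next
    fix i i' assume k: "k = Inr i" "k' = Inr i'"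
    then have ii: "i < n" "i' < n" using m m' by auto
    then have ii': "i \<in> {..<n}" "i' \<in> {..<n}" by auto
    have "(\<lambda>\<omega>. eps i \<omega> * eps i' \<omega>) \<in> borel_measurable (indep_algebra 2)"
      by (intro borel_measurable_times meas ii)
    from has_cond_exp_product[OF one this eps2(1)[OF ii'] xxm xx(2) one] eps2[of i i'] ii show ?thesis
      by (elim has_cond_exp_cong) (auto simp: noise_def k xx(3) prob_space)
  qed
  show "has_cond_exp M (design_algebra M n p \<gamma> Z) (\<lambda>\<omega>. epst \<omega> * (test_coord j \<omega> * noise k \<omega>)) (\<lambda>_. 0)"
  proof (cases k)
    case (Inl a)
    then have a: "a < p" using m by auto
    from has_cond_exp_product[OF meas(1)[OF a] conjunct1[OF beta_mean[OF a]] one meas(3)[OF j(1)] xx(1) meas(4) epst(2)] beta_mean[OF a]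
    show ?thesis by (elim has_cond_exp_cong) (auto simp: noise_def Inl)
  next
    case (Inr i)
    then have i: "i < n" using m by auto
    from has_cond_exp_product[OF one meas(2)[OF i] eps1(1)[OF i] meas(3)[OF j(1)] xx(1) meas(4) epst(2)] eps1(2)[OF i]
    show ?thesis by (elim has_cond_exp_cong) (auto simp: noise_def Inr)
  qed
qed

text \<open>The conditional Pythagorean identity applies to the expanded prediction error: the
  products \<open>test_coord j * noise k\<close> are the orthogonal family and \<open>epst\<close>
  is the extra term.\<close>

lemma emp_risk_eq:
  assumes pos: "0 < n" "0 < l"
  shows "AE \<omega> in M. emp_risk M n p \<gamma> \<gamma>t Z zt \<beta> eps epst l \<omega> = risk_formula \<tau> l \<omega>"
proof -
  have tt: "has_cond_exp M (design_algebra M n p \<gamma> Z) (\<lambda>\<omega>. (epst \<omega>)\<^sup>2) (\<lambda>_. \<sigma>\<^sup>2)"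
  proof (rule has_cond_exp_cong)
    show "has_cond_exp M (design_algebra M n p \<gamma> Z) (\<lambda>\<omega>. 1 * 1 * 1 * (epst \<omega>)\<^sup>2)
        (\<lambda>_. expectation (\<lambda>_. 1) * expectation (\<lambda>_. 1) * expectation (\<lambda>_. 1) * expectation (\<lambda>\<omega>. (epst \<omega>)\<^sup>2))"
      by (rule has_cond_exp_product)
        (use epst(4) indep_algebra_measurable(4) in \<open>auto intro: borel_measurable_power\<close>)
  qed (simp_all add: epst(5) prob_space)
  have "has_cond_exp M (design_algebra M n p \<gamma> Z)
      (\<lambda>\<omega>. ((\<Sum>m\<in>index_set. error_coeff l m \<omega> * (case m of (j, k) \<Rightarrow> test_coord j \<omega> * noise k \<omega>)) + epst \<omega>)\<^sup>2)
      (\<lambda>\<omega>. (\<Sum>m\<in>index_set. (case m of (j, k) \<Rightarrow> (\<gamma>t j)\<^sup>2 * case_sum (\<lambda>_. \<tau>) (\<lambda>_. \<sigma>\<^sup>2) k) * (error_coeff l m \<omega>)\<^sup>2) + \<sigma>\<^sup>2)"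
  proof (rule design.has_cond_exp_orthogonal_square[OF _ error_coeff_measurable[OF pos] error_coeff_bound[OF pos] _ _ tt])
    fix m m' assume "m \<in> index_set" "m' \<in> index_set"
    then show "has_cond_exp M (design_algebra M n p \<gamma> Z)
      (\<lambda>\<omega>. (case m of (j, k) \<Rightarrow> test_coord j \<omega> * noise k \<omega>) * (case m' of (j, k) \<Rightarrow> test_coord j \<omega> * noise k \<omega>))
      (\<lambda>\<omega>. if m = m' then (case m of (j, k) \<Rightarrow> (\<gamma>t j)\<^sup>2 * case_sum (\<lambda>_. \<tau>) (\<lambda>_. \<sigma>\<^sup>2) k) else 0)"
      using has_cond_exp_noise_products(1)[of "fst m" "snd m" "fst m'" "snd m'"]
      by (cases "m = m'") (simp_all add: case_prod_unfold)
  next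
    fix m assume "m \<in> index_set"
    then show "has_cond_exp M (design_algebra M n p \<gamma> Z)
      (\<lambda>\<omega>. epst \<omega> * (case m of (j, k) \<Rightarrow> test_coord j \<omega> * noise k \<omega>)) (\<lambda>\<omega>. 0)"
      using has_cond_exp_noise_products(2)[of "fst m" "snd m" "fst m" "snd m"]
      by (simp add: case_prod_unfold)
  qed simp_all
  then show ?thesis
    unfolding emp_risk_def test_error_eq[OF pos] has_cond_exp_def risk_formula_def
    by (simp add: case_prod_unfold)
qed

text \<open>The choice of \<open>l0\<close> makes
  \<open>\<sigma>\<^sup>2 = \<tau> * (n * l0)\<close>. Each \<open>j\<close> then contributes
  \<open>\<tau>\<close> times the quadratic functional of \<open>ridge_row_minimum\<close> with
  \<open>c0 = n * l0\<close>.\<close>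

lemma risk_formula_minimum:
  assumes pos: "0 < n" "0 < l" "0 < \<tau>" "0 < \<sigma>\<^sup>2"
  shows "risk_formula \<tau> (\<sigma>\<^sup>2 / (\<tau> * real n)) \<omega> \<le> risk_formula \<tau> l \<omega>"
proof -
  define l0 where "l0 = \<sigma>\<^sup>2 / (\<tau> * real n)"
  have l0: "0 < l0" and s: "\<sigma>\<^sup>2 = \<tau> * (real n * l0)" using pos by (simp_all add: l0_def)
  let ?X = "design_mat n p \<gamma> Z \<omega>"
  define E where "E l j = \<tau> * ((real n * l)\<^sup>2 * scalar_prod (ridge_row l j \<omega>) (ridge_row l j \<omega>)
      + real n * l0 * scalar_prod (?X *\<^sub>v ridge_row l j \<omega>) (?X *\<^sub>v ridge_row l j \<omega>))" for l j
  have risk: "risk_formula \<tau> l \<omega> = (\<Sum>j<p. (\<gamma>t j)\<^sup>2 * E l j) + \<sigma>\<^sup>2" if l: "0 < l" for l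
  proof -
    have "(\<Sum>k\<in>{..<p} <+> {..<n}. (\<gamma>t j)\<^sup>2 * case_sum (\<lambda>_. \<tau>) (\<lambda>_. \<sigma>\<^sup>2) k * (error_coeff l (j, k) \<omega>)\<^sup>2)
            = (\<gamma>t j)\<^sup>2 * E l j" if "j < p" for j
      using ridge_row_carrier[OF pos(1) l that, of \<omega>] design_carrier[of \<omega>]
      by (simp add: sum.Plus error_coeff_def E_def scalar_prod_self_sum s power_mult_distrib
          sum_distrib_left distrib_left mult_ac del: index_mult_mat_vec)
    then show ?thesis
      by (simp add: risk_formula_def flip: sum.cartesian_product)
  qed
  \<comment> \<open>The rows for \<open>l\<close> and \<open>l0\<close> are comparable because both
    Gram matrices send them to the same unit vector.\<close>
  have "E l0 j \<le> E l j" if j: "j < p" for j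
    unfolding E_def using pos l0
    by (intro mult_left_mono ridge_row_minimum[OF design_carrier]
        ridge_row_carrier[OF pos(1) _ j]) (simp_all add: ridge_row_eq[OF pos(1) _ j])
  then show ?thesis
    unfolding l0_def[symmetric] risk[OF l0] risk[OF pos(2)]
    by (intro add_right_mono sum_mono mult_left_mono) auto
qed

text \<open>Each of the two risks agrees with its formula off a null set, and the formulas compare
  at every outcome. The null set may depend on \<open>l\<close>.\<close>

lemma emp_risk_minimum:
  assumes pos: "0 < n" "0 < l" "0 < \<tau>" "0 < \<sigma>\<^sup>2"
  shows "AE \<omega> in M. emp_risk M n p \<gamma> \<gamma>t Z zt \<beta> eps epst (\<sigma>\<^sup>2 / (\<tau> * real n)) \<omega>
           \<le> emp_risk M n p \<gamma> \<gamma>t Z zt \<beta> eps epst l \<omega>"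
proof -
  have "0 < \<sigma>\<^sup>2 / (\<tau> * real n)" using pos by simp
  from emp_risk_eq[OF pos(1) this] emp_risk_eq[OF pos(1,2)] show ?thesis
    by eventually_elim (simp add: risk_formula_minimum[OF pos])
qed

end

end

theorem corollary3p1:
  fixes M :: "nat \<Rightarrow> 'a measure"
    and p :: "nat \<Rightarrow> nat"
    and \<gamma> :: "nat \<Rightarrow> nat \<Rightarrow> nat \<Rightarrow> real" and \<gamma>t :: "nat \<Rightarrow> nat \<Rightarrow> real"
    and Z :: "nat \<Rightarrow> nat \<Rightarrow> nat \<Rightarrow> 'a \<Rightarrow> real" and zt :: "nat \<Rightarrow> nat \<Rightarrow> 'a \<Rightarrow> real"
    and \<beta> :: "nat \<Rightarrow> nat \<Rightarrow> 'a \<Rightarrow> real"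
    and eps :: "nat \<Rightarrow> nat \<Rightarrow> 'a \<Rightarrow> real" and epst :: "nat \<Rightarrow> 'a \<Rightarrow> real"
    and T Tt :: "nat \<Rightarrow> nat \<Rightarrow> complex \<Rightarrow> complex"
    and \<sigma> \<alpha> \<delta> \<gamma>max :: real
  assumes p_pos: "\<And>n. 1 \<le> n \<Longrightarrow> 1 \<le> p n"
    and sigma_pos: "0 < \<sigma>\<^sup>2"
    and alpha_pos: "0 < \<alpha>"
    and model: "\<And>n. 1 \<le> n \<Longrightarrow>
          ridge_model (M n) n (p n) (\<gamma> n) (\<gamma>t n) (Z n) (zt n) (\<beta> n) (eps n) (epst n) \<sigma>"
    and T_solution: "\<And>n. 1 \<le> n \<Longrightarrow> canonical_solution n (p n) (\<gamma> n) (T n) (Tt n)"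
    and beta_mean: "\<And>n j. 1 \<le> n \<Longrightarrow> j < p n \<Longrightarrow>
          integrable (M n) (\<beta> n j) \<and> integral\<^sup>L (M n) (\<beta> n j) = 0"
    and beta_cov: "\<And>n j k. 1 \<le> n \<Longrightarrow> j < p n \<Longrightarrow> k < p n \<Longrightarrow>
          integrable (M n) (\<lambda>\<omega>. \<beta> n j \<omega> * \<beta> n k \<omega>) \<and>
          integral\<^sup>L (M n) (\<lambda>\<omega>. \<beta> n j \<omega> * \<beta> n k \<omega>) = (if j = k then \<alpha>\<^sup>2 / real (p n) else 0)"
    and delta_pos: "0 < \<delta>"
    and Z_moment: "\<And>n i j. 1 \<le> n \<Longrightarrow> i < n \<Longrightarrow> j < p n \<Longrightarrow>
          integrable (M n) (\<lambda>\<omega>. \<bar>Z n i j \<omega>\<bar> powr (4 + \<delta>))"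
    and zt_moment: "\<And>n j. 1 \<le> n \<Longrightarrow> j < p n \<Longrightarrow>
          integrable (M n) (\<lambda>\<omega>. \<bar>zt n j \<omega>\<bar> powr (4 + \<delta>))"
    and gamma_max_pos: "0 < \<gamma>max"
    and gamma_bound:
      "(SUP (n, i, j) \<in> {(n, i, j). 1 \<le> n \<and> i < n \<and> j < p n}.
          ereal (max \<bar>\<gamma> n i j\<bar> \<bar>\<gamma>t n j\<bar>)) < ereal \<gamma>max"
  shows "\<forall>n\<ge>1. \<forall>l>0.
      (AE \<omega> in M n.
         emp_risk (M n) n (p n) (\<gamma> n) (\<gamma>t n) (Z n) (zt n) (\<beta> n) (eps n) (epst n)
           (\<sigma>\<^sup>2 * real (p n) / (\<alpha>\<^sup>2 * real n)) \<omega>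
         \<le> emp_risk (M n) n (p n) (\<gamma> n) (\<gamma>t n) (Z n) (zt n) (\<beta> n) (eps n) (epst n) l \<omega>) \<and>
      det_risk n (p n) (\<gamma>t n) (T n) \<sigma> \<alpha> (\<sigma>\<^sup>2 * real (p n) / (\<alpha>\<^sup>2 * real n))
         \<le> det_risk n (p n) (\<gamma>t n) (T n) \<sigma> \<alpha> l"
proof (intro allI impI conjI)
  fix n :: nat and l :: real
  assume n: "1 \<le> n" and l: "0 < l"
  interpret ridge_model "M n" n "p n" "\<gamma> n" "\<gamma>t n" "Z n" "zt n" "\<beta> n" "eps n" "epst n" \<sigma>
    by (rule model[OF n])
  have pos: "0 < n" "0 < p n" "0 < \<alpha>\<^sup>2 / real (p n)"
    using n p_pos[OF n] alpha_pos by auto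
  \<comment> \<open>This is the minimiser \<open>\<sigma>\<^sup>2 / (\<tau> * n)\<close> for the
    coordinate variance \<open>\<tau> = \<alpha>\<^sup>2 / p\<close>.\<close>
  have l0: "\<sigma>\<^sup>2 * real (p n) / (\<alpha>\<^sup>2 * real n) = \<sigma>\<^sup>2 / (\<alpha>\<^sup>2 / real (p n) * real n)"
    by simp
  show "AE \<omega> in M n.
      emp_risk (M n) n (p n) (\<gamma> n) (\<gamma>t n) (Z n) (zt n) (\<beta> n) (eps n) (epst n)
        (\<sigma>\<^sup>2 * real (p n) / (\<alpha>\<^sup>2 * real n)) \<omega>
      \<le> emp_risk (M n) n (p n) (\<gamma> n) (\<gamma>t n) (Z n) (zt n) (\<beta> n) (eps n) (epst n) l \<omega>"
    unfolding l0
    by (rule emp_risk_minimum[OF beta_mean[OF n] beta_cov[OF n] pos(1) l pos(3) sigma_pos])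
  have "stieltjes_transform_nonneg (T n j)" if "j < p n" for j
    using T_solution[OF n] that by (auto simp: canonical_solution_def)
  then show "det_risk n (p n) (\<gamma>t n) (T n) \<sigma> \<alpha> (\<sigma>\<^sup>2 * real (p n) / (\<alpha>\<^sup>2 * real n))
      \<le> det_risk n (p n) (\<gamma>t n) (T n) \<sigma> \<alpha> l"
    by (rule det_risk_minimum[OF _ sigma_pos alpha_pos pos(1,2) l])
qed

end
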